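(* Let $x^*\in\mathcal{M}$ satisfy $f(x^* )=0$. Suppose that: (a) there exist $b\in(0,\infty)$ and $c_1\in(0,\infty)$ such that $\|J(y)R_y^{-1}(x)-(F(x)-F(y))\|\le c_1\|R_y^{-1}(x)\|^2$ for all $x,y\in B(x^*,b)$; (b) there exists $c_2>0$ such that $c_2\|R_x^{-1}(\bar x)\|\le\|F(x)-F(\bar x)\|=\|F(x)\|$ for all $x\in B(x^*,b)$; (c) $\{\mu_k\}$ is bounded above by a positive constant $\mu_{\max}^{\mathrm z}$. Assume that $b$ is small enough in the sense specified in the context, and let $$r:=\min\left\{\frac{b}{2+4c^2c_3},\frac{1}{2c_5}\right\},$$ with the constants $c,c_3,c_5$ defined in the context. If $x_0\in B(x^*,r)$, then the sequence $\{x_k\}$ generated by the Riemannian Levenberg–Marquardt (RLM) algorithm of the context satisfies: $\{\mathrm{Dist}(x_k,X^* )\}$ converges to $0$ quadratically, and $\{x_k\}$ converges to some $\hat x\in B(x^*,\frac b2)$.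
   Context: $(\mathcal{M},\langle\cdot,\cdot\rangle)$ is a connected, complete Riemannian manifold of dimension $n$ with Riemannian distance $\mathrm{dist}$, $F=(F_1,\dots,F_m)^T:\mathcal{M}\to\mathbb{R}^m$ is continuously differentiable, $f(x):=\frac12\|F(x)\|^2$. $R:T\mathcal{M}\to\mathcal{M}$ is a retraction: a smooth map whose restriction $R_x$ to $T_x\mathcal{M}$ satisfies $R_x(0_x)=x$, $dR_x(0_x)=\mathrm{id}$. $J(x)s:=(\langle\mathrm{grad}F_i(x),s\rangle_x)_{i=1}^m$ for $s\in T_x\mathcal{M}$, $J(x)^*$ its adjoint, $J_k:=J(x_k)$. RLM algorithm. Inputs: $x_0$, $\eta\in(0,1)$, $\mu_{\min}>0$, $\beta>1$. Set $\mu_0=\mu_{\min}$. For $k=0,1,\dots$: $\lambda_k:=\mu_k\|F(x_k)\|^2$, $\theta^k(s):=\|F(x_k)+J_ks\|^2+\lambda_k\|s\|_{x_k}^2$ on $T_{x_k}\mathcal{M}$, $s_k:=\arg\min\theta^k$, $\rho_k:=\frac{f(x_k)-f(R_{x_k}(s_k))}{\frac12(\theta^k(0)-\theta^k(s_k))}$. If $\rho_k\ge\eta$ (iteration "successful"), $x_{k+1}=R_{x_k}(s_k)$, $\mu_{k+1}=\max(\mu_{\min},\mu_k/\beta)$; otherwise $x_{k+1}=x_k$, $\mu_{k+1}=\beta\mu_k$. If $\mathrm{grad}f(x_k)=0$, then $s_k=0$, $x_{k+1}=x_k$ and the iteration counts as successful. Notation. $X^*:=\{x\in\mathcal{M}\mid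 \mathrm{grad}f(x)=0,\ f(x)=f(x^* )\}$; $\mathrm{Dist}(x,X^* ):=\min_{\hat x\in X^*}\mathrm{dist}(x,\hat x)$; $\bar x$ (or $\overline{x_k}$) is a point of $X^*$ closest to $x$ (to $x_k$). $B(x,b):=\{y\mid\mathrm{dist}(x,y)\le b\}$. $R_x^{-1}$ is the inverse of $R_x$ on a neighbourhood $U$ of $0_x$ on which $R_x$ is a diffeomorphism onto its image; $R_x^{-1}(y)$ is understood to be defined wherever written. $\mathrm{Inj}^R(x)$ is the supremum of radii $r>0$ such that $R_x$ is a diffeomorphism on $\{v\in T_x\mathcal{M}:\|v\|_x<r\}$. A sequence $a_k\to0$ converges quadratically if $a_{k+1}\le Ca_k^2$ for some constant $C$. Constants. $\lambda_{\min},\lambda_{\max}$ are the minimum and maximum eigenvalues over $B(x^*,b)$ of the matrix of the Riemannian metric in the local coordinates given by $R_x^{-1}$, $x\in B(x^*,b)$ (with $T_x\mathcal{M}$ identified with $\mathbb{R}^n$), and $c:=\sqrt{\lambda_{\max}/\lambda_{\min}}\ge1$. $L>0$ is a constant with $\|F(x)-F(y)\|\le L\|R_y^{-1}(x)\|$ for all $x,y\in B(x^*,b)$. Further $$c_3:=\sqrt{\tfrac{c_1^2+c_2^2\mu_{\min}}{c_2^2\mu_{\min}}},\quad c_4:=\sqrt{c_1^2+L^2\mu_{\max}^{\mathrm z}},\quad c_5:=\frac{c^3(c_1c_3^2+c_4)}{c_2},\quad c^*:=\frac{-cc_2c_4+\sqrt{c^2c_2^2c_4^2+4c^2\mu_{\max}^{\mathrm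 z}c_2^2c_3^2L^2}}{2c^2\mu_{\max}^{\mathrm z}c_3^2L^2}.$$ Smallness of $b$: $B(x^*,b)\subset R_{x^*}(\{v\in T_{x^*}\mathcal{M}:\|v\|<\mathrm{Inj}^R(x^* )\})$; $b\le\frac{2c_2}{cc_4}$; $\frac b2<c^*$; $\frac b2\le r^*$, where $r^*>0$ is a constant such that any iteration $k$ with $x_k\in B(x^*,\min\{\frac b2,r^*\})$ and $\mathrm{dist}(x_k,x^* )<c^*$ is successful; and $b\le b^*$, where $b^*>0$ is a constant such that $\inf_{x\in B(x^*,b'/2)}\mathrm{Inj}^R(x)\ge\frac{b'cc_3}{2}$ for all $0<b'\le b^*$. *)

theory Defs
  imports "HOL-Analysis.Analysis"
begin

section \<open>Smooth maps between Euclidean spaces\<close>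

text \<open>Both notions are meant for open sets \<open>S\<close>.\<close>

primrec Ck_on :: "nat \<Rightarrow> 'a::real_normed_vector set \<Rightarrow> ('a \<Rightarrow> 'b::real_normed_vector) \<Rightarrow> bool" where
  "Ck_on 0 S f \<longleftrightarrow> continuous_on S f"
| "Ck_on (Suc k) S f \<longleftrightarrow>
     (\<forall>x\<in>S. f differentiable (at x)) \<and> (\<forall>v. Ck_on k S (\<lambda>x. frechet_derivative f (at x) v))"

definition smooth_on :: "'a::real_normed_vector set \<Rightarrow> ('a \<Rightarrow> 'b::real_normed_vector) \<Rightarrow> bool" where
  "smooth_on S f \<longleftrightarrow> (\<forall>k. Ck_on k S f)"

section \<open>Riemannian manifolds\<close>

text \<open>
  The points of the manifold are all elements of a topological type \<open>'a\<close>; its dimension is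
  \<open>CARD('n)\<close>. A chart is a pair of a domain and a coordinate map.

  Tangent vectors: every point \<open>x\<close> carries a distinguished chart \<open>chart_at M x\<close>, and
  \<open>v :: real^'n\<close>, regarded as an element of the tangent space at \<open>x\<close>, stands for the tangent
  vector whose coordinates in that distinguished chart are \<open>v\<close>. So each tangent space is the
  whole vector space \<open>real^'n\<close>. The distinguished chart need not depend continuously on \<open>x\<close>;
  anything that varies with the base point is therefore expressed in a fixed chart of the atlas
  before its smoothness is stated. The norm of a tangent vector is \<open>tnorm\<close> below, not the
  Euclidean norm of \<open>real^'n\<close>.
\<close>

type_synonym ('a, 'n) chart = "'a set \<times> ('a \<Rightarrow> real^'n)"

record ('a, 'n::finite) riem =
  atlas :: "('a, 'n) chart set"
  chart_at :: "'a \<Rightarrow> ('a, 'n) chart"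
  metric :: "'a \<Rightarrow> real^'n \<Rightarrow> real^'n \<Rightarrow> real"

definition chart_image :: "('a, 'n::finite) chart \<Rightarrow> (real^'n) set" where
  "chart_image \<kappa> = snd \<kappa> ` fst \<kappa>"

definition chart_inv :: "('a, 'n::finite) chart \<Rightarrow> real^'n \<Rightarrow> 'a" where
  "chart_inv \<kappa> = inv_into (fst \<kappa>) (snd \<kappa>)"

definition is_chart :: "('a::topological_space, 'n::finite) chart \<Rightarrow> bool" where
  "is_chart \<kappa> \<longleftrightarrow> open (fst \<kappa>) \<and> open (chart_image \<kappa>) \<and>
     homeomorphism (fst \<kappa>) (chart_image \<kappa>) (snd \<kappa>) (chart_inv \<kappa>)"

definition smooth_manifold ::
  "('a::{t2_space,second_countable_topology}, 'n::finite) riem \<Rightarrow> bool" where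
  "smooth_manifold M \<longleftrightarrow>
     (\<forall>\<kappa>\<in>atlas M. is_chart \<kappa>) \<and>
     (\<forall>\<kappa>\<in>atlas M. \<forall>\<kappa>'\<in>atlas M.
        smooth_on (snd \<kappa> ` (fst \<kappa> \<inter> fst \<kappa>')) (snd \<kappa>' \<circ> chart_inv \<kappa>)) \<and>
     (\<forall>x. chart_at M x \<in> atlas M \<and> x \<in> fst (chart_at M x))"

text \<open>The tangent vector at \<open>x\<close> whose coordinates in the chart \<open>\<kappa>\<close> are \<open>w\<close>.\<close>

definition tvec :: "('a, 'n::finite) riem \<Rightarrow> ('a, 'n) chart \<Rightarrow> 'a \<Rightarrow> real^'n \<Rightarrow> real^'n" where
  "tvec M \<kappa> x w = frechet_derivative (snd (chart_at M x) \<circ> chart_inv \<kappa>) (at (snd \<kappa> x)) w"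

definition riemannian_manifold ::
  "('a::{t2_space,second_countable_topology}, 'n::finite) riem \<Rightarrow> bool" where
  "riemannian_manifold M \<longleftrightarrow>
     smooth_manifold M \<and>
     (\<forall>x. bilinear (metric M x) \<and> (\<forall>v w. metric M x v w = metric M x w v) \<and>
          (\<forall>v. v \<noteq> 0 \<longrightarrow> metric M x v v > 0)) \<and>
     (\<forall>\<kappa>\<in>atlas M. \<forall>v w. smooth_on (chart_image \<kappa>)
        (\<lambda>p. metric M (chart_inv \<kappa> p) (tvec M \<kappa> (chart_inv \<kappa> p) v) (tvec M \<kappa> (chart_inv \<kappa> p) w)))"

definition tnorm :: "('a, 'n::finite) riem \<Rightarrow> 'a \<Rightarrow> real^'n \<Rightarrow> real" where
  "tnorm M x v = sqrt (metric M x v v)"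

subsection \<open>Riemannian distance\<close>

text \<open>
  Piecewise continuously differentiable, with one-sided derivatives at the finitely many
  breakpoints \<open>S\<close>: on every subinterval without a breakpoint in its interior and mapped into a
  single chart, the curve is continuously differentiable up to the end points.
\<close>

definition pw_C1_curve :: "('a::topological_space, 'n::finite) riem \<Rightarrow> (real \<Rightarrow> 'a) \<Rightarrow> bool" where
  "pw_C1_curve M \<gamma> \<longleftrightarrow> continuous_on {0..1} \<gamma> \<and>
     (\<exists>S. finite S \<and>
       (\<forall>\<kappa>\<in>atlas M. \<forall>a b. 0 \<le> a \<and> a < b \<and> b \<le> 1 \<and> {a<..<b} \<inter> S = {} \<and> \<gamma> ` {a..b} \<subseteq> fst \<kappa> \<longrightarrow>
          (\<exists>d. continuous_on {a..b} d \<and>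
               (\<forall>t\<in>{a..b}. ((snd \<kappa> \<circ> \<gamma>) has_vector_derivative d t) (at t within {a..b})))))"

definition velocity :: "('a, 'n::finite) riem \<Rightarrow> (real \<Rightarrow> 'a) \<Rightarrow> real \<Rightarrow> real^'n" where
  "velocity M \<gamma> t = vector_derivative (snd (chart_at M (\<gamma> t)) \<circ> \<gamma>) (at t)"

definition curve_length :: "('a, 'n::finite) riem \<Rightarrow> (real \<Rightarrow> 'a) \<Rightarrow> real" where
  "curve_length M \<gamma> = integral {0..1} (\<lambda>t. tnorm M (\<gamma> t) (velocity M \<gamma> t))"

definition rdist :: "('a::topological_space, 'n::finite) riem \<Rightarrow> 'a \<Rightarrow> 'a \<Rightarrow> real" where
  "rdist M x y = (INF \<gamma>\<in>{\<gamma>. pw_C1_curve M \<gamma> \<and> \<gamma> 0 = x \<and> \<gamma> 1 = y}. curve_length M \<gamma>)"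

definition rcball :: "('a::topological_space, 'n::finite) riem \<Rightarrow> 'a \<Rightarrow> real \<Rightarrow> 'a set" where
  "rcball M x r = {y. rdist M x y \<le> r}"

definition rconverges :: "('a::topological_space, 'n::finite) riem \<Rightarrow> (nat \<Rightarrow> 'a) \<Rightarrow> 'a \<Rightarrow> bool" where
  "rconverges M X l \<longleftrightarrow> (\<lambda>k. rdist M (X k) l) \<longlonglongrightarrow> 0"

definition rcomplete :: "('a::topological_space, 'n::finite) riem \<Rightarrow> bool" where
  "rcomplete M \<longleftrightarrow>
     (\<forall>X. (\<forall>e>0. \<exists>N. \<forall>m\<ge>N. \<forall>k\<ge>N. rdist M (X m) (X k) < e) \<longrightarrow> (\<exists>l. rconverges M X l))"

definition dist_to :: "('a::topological_space, 'n::finite) riem \<Rightarrow> 'a \<Rightarrow> 'a set \<Rightarrow> real" where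
  "dist_to M x S = (INF y\<in>S. rdist M x y)"

definition is_nearest :: "('a::topological_space, 'n::finite) riem \<Rightarrow> 'a set \<Rightarrow> 'a \<Rightarrow> 'a \<Rightarrow> bool" where
  "is_nearest M S x y \<longleftrightarrow> y \<in> S \<and> (\<forall>z\<in>S. rdist M x y \<le> rdist M x z)"

section \<open>Functions on a manifold\<close>

definition C1_map :: "('a, 'n::finite) riem \<Rightarrow> ('a \<Rightarrow> 'b::real_normed_vector) \<Rightarrow> bool" where
  "C1_map M h \<longleftrightarrow> (\<forall>\<kappa>\<in>atlas M. Ck_on 1 (chart_image \<kappa>) (h \<circ> chart_inv \<kappa>))"

definition differential ::
  "('a, 'n::finite) riem \<Rightarrow> ('a \<Rightarrow> 'b::real_normed_vector) \<Rightarrow> 'a \<Rightarrow> real^'n \<Rightarrow> 'b" where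
  "differential M h x v =
     frechet_derivative (h \<circ> chart_inv (chart_at M x)) (at (snd (chart_at M x) x)) v"

definition grad :: "('a, 'n::finite) riem \<Rightarrow> ('a \<Rightarrow> real) \<Rightarrow> 'a \<Rightarrow> real^'n" where
  "grad M h x = (THE w. \<forall>v. metric M x w v = differential M h x v)"

definition jac :: "('a, 'n::finite) riem \<Rightarrow> ('a \<Rightarrow> real^'m::finite) \<Rightarrow> 'a \<Rightarrow> real^'n \<Rightarrow> real^'m" where
  "jac M F x v = (\<chi> i. metric M x (grad M (\<lambda>y. F y $ i) x) v)"

definition half_sq :: "('a \<Rightarrow> real^'m::finite) \<Rightarrow> 'a \<Rightarrow> real" where
  "half_sq F x = (norm (F x))\<^sup>2 / 2"

definition sol_set :: "('a, 'n::finite) riem \<Rightarrow> ('a \<Rightarrow> real^'m::finite) \<Rightarrow> 'a \<Rightarrow> 'a set" where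
  "sol_set M F xs = {x. grad M (half_sq F) x = 0 \<and> half_sq F x = half_sq F xs}"

section \<open>Retractions\<close>

text \<open>
  Smoothness on the tangent bundle: \<open>(p, v)\<close> are the bundle coordinates induced by the chart
  \<open>\<kappa>\<close>; openness of the set \<open>W\<close> expresses continuity.
\<close>

definition retraction_on :: "('a, 'n::finite) riem \<Rightarrow> ('a \<Rightarrow> real^'n \<Rightarrow> 'a) \<Rightarrow> bool" where
  "retraction_on M R \<longleftrightarrow>
     (\<forall>\<kappa>\<in>atlas M. \<forall>\<kappa>'\<in>atlas M.
        let h = (\<lambda>(p, v). R (chart_inv \<kappa> p) (tvec M \<kappa> (chart_inv \<kappa> p) v));
            W = {(p, v). p \<in> chart_image \<kappa> \<and> h (p, v) \<in> fst \<kappa>'}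
        in open W \<and> smooth_on W (snd \<kappa>' \<circ> h)) \<and>
     (\<forall>x. R x 0 = x) \<and>
     (\<forall>x. ((snd (chart_at M x) \<circ> R x) has_derivative id) (at 0))"

definition dR :: "('a, 'n::finite) riem \<Rightarrow> ('a \<Rightarrow> real^'n \<Rightarrow> 'a) \<Rightarrow> 'a \<Rightarrow> real^'n \<Rightarrow> real^'n \<Rightarrow> real^'n" where
  "dR M R x u v = frechet_derivative (snd (chart_at M (R x u)) \<circ> R x) (at u) v"

definition diffeo_onto_image ::
  "('a::topological_space, 'n::finite) riem \<Rightarrow> (real^'n \<Rightarrow> 'a) \<Rightarrow> (real^'n) set \<Rightarrow> bool" where
  "diffeo_onto_image M h V \<longleftrightarrow>
     open V \<and> inj_on h V \<and> open (h ` V) \<and>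
     (\<forall>\<kappa>\<in>atlas M. open (V \<inter> h -` fst \<kappa>) \<and> smooth_on (V \<inter> h -` fst \<kappa>) (snd \<kappa> \<circ> h)) \<and>
     (\<forall>\<kappa>\<in>atlas M. smooth_on (snd \<kappa> ` (h ` V \<inter> fst \<kappa>)) (inv_into V h \<circ> chart_inv \<kappa>))"

text \<open>The supremum is taken in the extended reals, as it may be infinite.\<close>

definition inj_radius ::
  "('a::topological_space, 'n::finite) riem \<Rightarrow> ('a \<Rightarrow> real^'n \<Rightarrow> 'a) \<Rightarrow> 'a \<Rightarrow> ereal" where
  "inj_radius M R x = Sup (ereal ` {r. r > 0 \<and> diffeo_onto_image M (R x) {v. tnorm M x v < r}})"

text \<open>
  \<open>U x\<close> is the chosen neighbourhood of the zero vector at \<open>x\<close> on which \<open>R x\<close> is a diffeomorphism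
  onto its image. Outside \<open>R x ` U x\<close> the value of \<open>Rinv\<close> is meaningless; its use must be
  accompanied by the corresponding membership.
\<close>

definition Rinv :: "('a \<Rightarrow> real^'n::finite \<Rightarrow> 'a) \<Rightarrow> ('a \<Rightarrow> (real^'n) set) \<Rightarrow> 'a \<Rightarrow> 'a \<Rightarrow> real^'n" where
  "Rinv R U x y = inv_into (U x) (R x) y"

text \<open>
  The matrix of the metric at the point \<open>y\<close> in the local coordinates given by the inverse of
  \<open>R x\<close>, where the tangent space at \<open>x\<close> is identified with \<open>real^'n\<close> by the orthonormal basis \<open>e\<close>.
  Its eigenvalues do not depend on \<open>e\<close>.
\<close>

definition orthonormal_frame :: "('a, 'n::finite) riem \<Rightarrow> 'a \<Rightarrow> ('n \<Rightarrow> real^'n) \<Rightarrow> bool" where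
  "orthonormal_frame M x e \<longleftrightarrow> (\<forall>i j. metric M x (e i) (e j) = (if i = j then 1 else 0))"

definition metric_matrix ::
  "('a, 'n::finite) riem \<Rightarrow> ('a \<Rightarrow> real^'n \<Rightarrow> 'a) \<Rightarrow> ('a \<Rightarrow> (real^'n) set) \<Rightarrow> ('n \<Rightarrow> real^'n) \<Rightarrow> 'a \<Rightarrow> 'a
     \<Rightarrow> real^'n^'n" where
  "metric_matrix M R U e x y =
     (\<chi> i j. metric M y (dR M R x (Rinv R U x y) (e i)) (dR M R x (Rinv R U x y) (e j)))"

definition matrix_eigenvalue :: "real^'n^'n \<Rightarrow> real \<Rightarrow> bool" where
  "matrix_eigenvalue A l \<longleftrightarrow> (\<exists>w. w \<noteq> 0 \<and> A *v w = l *\<^sub>R w)"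

definition metric_eigenvalues ::
  "('a, 'n::finite) riem \<Rightarrow> ('a \<Rightarrow> real^'n \<Rightarrow> 'a) \<Rightarrow> ('a \<Rightarrow> (real^'n) set) \<Rightarrow> 'a set \<Rightarrow> real set" where
  "metric_eigenvalues M R U B =
     {l. \<exists>x\<in>B. \<exists>y\<in>B. \<exists>e. orthonormal_frame M x e \<and> matrix_eigenvalue (metric_matrix M R U e x y) l}"

section \<open>The Riemannian Levenberg--Marquardt iteration\<close>

definition lm_model ::
  "('a, 'n::finite) riem \<Rightarrow> ('a \<Rightarrow> real^'m::finite) \<Rightarrow> real \<Rightarrow> 'a \<Rightarrow> real^'n \<Rightarrow> real" where
  "lm_model M F \<mu> x s =
     (let lam = \<mu> * (norm (F x))\<^sup>2 in (norm (F x + jac M F x s))\<^sup>2 + lam * (tnorm M x s)\<^sup>2)"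

definition lm_ratio ::
  "('a, 'n::finite) riem \<Rightarrow> ('a \<Rightarrow> real^'n \<Rightarrow> 'a) \<Rightarrow> ('a \<Rightarrow> real^'m::finite) \<Rightarrow> real \<Rightarrow> 'a \<Rightarrow> real^'n \<Rightarrow> real" where
  "lm_ratio M R F \<mu> x s =
     (half_sq F x - half_sq F (R x s)) / ((lm_model M F \<mu> x 0 - lm_model M F \<mu> x s) / 2)"

definition lm_successful ::
  "('a, 'n::finite) riem \<Rightarrow> ('a \<Rightarrow> real^'n \<Rightarrow> 'a) \<Rightarrow> ('a \<Rightarrow> real^'m::finite) \<Rightarrow> real \<Rightarrow>
     real \<Rightarrow> 'a \<Rightarrow> real^'n \<Rightarrow> bool" where
  "lm_successful M R F \<eta> \<mu> x s \<longleftrightarrow> grad M (half_sq F) x = 0 \<or> lm_ratio M R F \<mu> x s \<ge> \<eta>"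

text \<open>
  At a critical point the step is zero by convention: the model need not have a unique minimiser
  there, and the ratio is 0/0.
\<close>

definition rlm_sequence ::
  "('a, 'n::finite) riem \<Rightarrow> ('a \<Rightarrow> real^'n \<Rightarrow> 'a) \<Rightarrow> ('a \<Rightarrow> real^'m::finite) \<Rightarrow> real \<Rightarrow> real \<Rightarrow> real \<Rightarrow>
     (nat \<Rightarrow> 'a) \<Rightarrow> (nat \<Rightarrow> real) \<Rightarrow> (nat \<Rightarrow> real^'n) \<Rightarrow> bool" where
  "rlm_sequence M R F \<eta> \<mu>min \<beta> x \<mu> s \<longleftrightarrow>
     \<mu> 0 = \<mu>min \<and>
     (\<forall>k. (if grad M (half_sq F) (x k) = 0 then s k = 0
           else is_arg_min (lm_model M F (\<mu> k) (x k)) (\<lambda>_. True) (s k)) \<and>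
          (if lm_successful M R F \<eta> (\<mu> k) (x k) (s k)
           then x (Suc k) = R (x k) (s k) \<and> \<mu> (Suc k) = max \<mu>min (\<mu> k / \<beta>)
           else x (Suc k) = x k \<and> \<mu> (Suc k) = \<beta> * \<mu> k))"

definition quadratically_to_0 :: "(nat \<Rightarrow> real) \<Rightarrow> bool" where
  "quadratically_to_0 a \<longleftrightarrow> a \<longlonglongrightarrow> 0 \<and> (\<exists>C. \<forall>k. a (Suc k) \<le> C * (a k)\<^sup>2)"

end

theory Submission
  imports Defs
begin

text \<open>
  The eigenvalue bounds say that the derivative of \<open>R x\<close> distorts norms by a factor at most \<open>c\<close>
  as long as one stays in the ball around \<open>xs\<close>. Integrating this along rays \<open>R x (t v)\<close>, and along
  almost shortest curves pulled back by the inverse of \<open>R x\<close>, compares the distance from \<open>x\<close> with the norm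
  of \<open>Rinv x\<close>. With this, the analysis is that of the Euclidean Levenberg--Marquardt method:
  comparing the model at \<open>s k\<close> with its value at \<open>v = Rinv (x k) (nearest (x k))\<close> yields
  \<open>|s k| \<le> c3 |v|\<close> and \<open>|F + J s k| \<le> c4 |v|\<^sup>2\<close>, hence by the error bound
  \<open>Dist (k + 1) \<le> c5 (Dist k)\<^sup>2\<close>. The choice of \<open>r\<close> makes \<open>Dist k \<le> r / 2^k\<close>, so that the step lengths
  sum to less than \<open>b / 2 - r\<close>, the iterates never leave the ball of radius \<open>b / 2\<close>, every
  iteration is successful, and the iterates form a Cauchy sequence.
\<close>

text \<open>Each constant records one use of the hypotheses. Dropping the step norm from the model
  comparison and using \<open>|F| \<le> L |v|\<close> and \<open>\<mu> k \<le> \<mu>max\<close>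
  gives \<open>c4\<close>; dropping the residual at \<open>s k\<close> and using
  \<open>c2 |v| \<le> |F|\<close> and \<open>\<mu>min \<le> \<mu> k\<close> gives \<open>c3\<close>.
  In \<open>c5\<close>, \<open>c1 * c3^2\<close> is the linearisation error of the step and
  \<open>c4\<close> its model residual; two factors \<open>c\<close> convert \<open>|v|^2\<close>
  into the squared old distance, the third converts the retraction vector at the new iterate into
  the new distance.

  The bound \<open>b \<le> 2 * c2 / (c * c4)\<close> excludes critical points with
  \<open>F \<noteq> 0\<close> from the half ball. At such a point the algorithm takes a zero step by
  convention, and no model comparison is available.

  The geometric obstacle is a circularity: the differential of the retraction is controlled only
  inside the ball, while staying inside the ball is what this control has to prove. Moreover, that
  \<open>s k\<close> lies in the arbitrary neighbourhood \<open>U (x k)\<close> has to be derived as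
  well, or (a) would say nothing about the step.\<close>

lemma Ck_on_1D:
  assumes "Ck_on 1 S f"
  shows "x \<in> S \<Longrightarrow> f differentiable (at x)"
    and "continuous_on S (\<lambda>x. frechet_derivative f (at x) v)"
  using assms by (auto simp: One_nat_def simp del: One_nat_def[symmetric])

lemma smooth_onD:
  assumes "smooth_on S f"
  shows "continuous_on S f"
    and "x \<in> S \<Longrightarrow> f differentiable (at x)"
    and "continuous_on S (\<lambda>x. frechet_derivative f (at x) v)"
proof -
  have "Ck_on 0 S f" "Ck_on 1 S f"
    using assms unfolding smooth_on_def by blast+
  then show "continuous_on S f" "x \<in> S \<Longrightarrow> f differentiable (at x)"
    "continuous_on S (\<lambda>x. frechet_derivative f (at x) v)"
    using Ck_on_1D by auto
qed

lemma smooth_on_has_derivative: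
  assumes "smooth_on S f" "x \<in> S"
  shows "(f has_derivative frechet_derivative f (at x)) (at x)"
  using smooth_onD(2)[OF assms] frechet_derivative_works by blast

section \<open>Piecewise continuously differentiable curves on arbitrary intervals\<close>

definition speed :: "('a::topological_space, 'n::finite) riem \<Rightarrow> (real \<Rightarrow> 'a) \<Rightarrow> real \<Rightarrow> real" where
  "speed M \<gamma> t = tnorm M (\<gamma> t) (velocity M \<gamma> t)"

definition C1_in_chart :: "('a::topological_space, 'n::finite) chart \<Rightarrow> (real \<Rightarrow> 'a) \<Rightarrow> real \<Rightarrow> real \<Rightarrow> bool" where
  "C1_in_chart \<kappa> \<gamma> a b \<longleftrightarrow> (\<exists>d. continuous_on {a..b} d \<and>
     (\<forall>t\<in>{a..b}. ((snd \<kappa> \<circ> \<gamma>) has_vector_derivative d t) (at t within {a..b})))"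

definition C1_off ::
  "('a::topological_space, 'n::finite) riem \<Rightarrow> real \<Rightarrow> real \<Rightarrow> (real \<Rightarrow> 'a) \<Rightarrow> real set \<Rightarrow> bool" where
  "C1_off M l u \<gamma> S \<longleftrightarrow> (\<forall>\<kappa>\<in>atlas M. \<forall>a b.
     l \<le> a \<and> a < b \<and> b \<le> u \<and> {a<..<b} \<inter> S = {} \<and> \<gamma> ` {a..b} \<subseteq> fst \<kappa> \<longrightarrow> C1_in_chart \<kappa> \<gamma> a b)"

text \<open>The interval is a parameter so that curves can be cut and glued before they are rescaled
  to \<open>{0..1}\<close>. The breakpoints are an explicit set in \<open>C1_off\<close> because
  gluing takes unions of such sets and reparametrising takes preimages.\<close>

definition pw_C1_on :: "('a::topological_space, 'n::finite) riem \<Rightarrow> real \<Rightarrow> real \<Rightarrow> (real \<Rightarrow> 'a) \<Rightarrow> bool" where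
  "pw_C1_on M l u \<gamma> \<longleftrightarrow> continuous_on {l..u} \<gamma> \<and> (\<exists>S. finite S \<and> C1_off M l u \<gamma> S)"

lemma pw_C1_onE:
  assumes "pw_C1_on M l u \<gamma>"
  obtains S where "finite S" "C1_off M l u \<gamma> S"
  using assms unfolding pw_C1_on_def by blast

lemma C1_offD:
  assumes "C1_off M l u \<gamma> S" "\<kappa> \<in> atlas M" "l \<le> a" "a < b" "b \<le> u" "{a<..<b} \<inter> S = {}"
    and "\<gamma> ` {a..b} \<subseteq> fst \<kappa>"
  shows "C1_in_chart \<kappa> \<gamma> a b"
  using assms unfolding C1_off_def by blast

lemma pw_C1_onI:
  assumes "continuous_on {l..u} \<gamma>" "finite S"
    and "\<And>\<kappa> a b. \<kappa> \<in> atlas M \<Longrightarrow> l \<le> a \<Longrightarrow> a < b \<Longrightarrow> b \<le> u \<Longrightarrow> {a<..<b} \<inter> S = {} \<Longrightarrow>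
      \<gamma> ` {a..b} \<subseteq> fst \<kappa> \<Longrightarrow> C1_in_chart \<kappa> \<gamma> a b"
  shows "pw_C1_on M l u \<gamma>"
  unfolding pw_C1_on_def C1_off_def
  using assms(1,2) by (intro conjI exI[of _ S] ballI allI impI assms(3)) simp_all

lemma pw_C1_on_continuous: "pw_C1_on M l u \<gamma> \<Longrightarrow> continuous_on {l..u} \<gamma>"
  by (simp add: pw_C1_on_def)

lemma pw_C1_curve_iff: "pw_C1_curve M \<gamma> \<longleftrightarrow> pw_C1_on M 0 1 \<gamma>"
  by (simp add: pw_C1_curve_def pw_C1_on_def C1_off_def C1_in_chart_def)

lemma curve_length_eq: "curve_length M \<gamma> = integral {0..1} (speed M \<gamma>)"
  by (simp add: curve_length_def speed_def[abs_def])

text \<open>\<open>vector_derivative\<close> is a choice among all derivatives, with an arbitrary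
  value where there is none. Equality at every \<open>t\<close> therefore comes from showing that
  both curves admit the same candidates \<open>d\<close>.\<close>

lemma velocity_cong:
  assumes "open T" "t \<in> T" "\<And>s. s \<in> T \<Longrightarrow> \<gamma> s = \<gamma>' s"
  shows "velocity M \<gamma> t = velocity M \<gamma>' t"
proof -
  have *: "((snd \<kappa> \<circ> \<gamma>\<^sub>2) has_vector_derivative d) (at t)"
    if "((snd \<kappa> \<circ> \<gamma>\<^sub>1) has_vector_derivative d) (at t)" "\<And>s. s \<in> T \<Longrightarrow> \<gamma>\<^sub>1 s = \<gamma>\<^sub>2 s"
    for d and \<kappa> :: "('a, 'b) chart" and \<gamma>\<^sub>1 \<gamma>\<^sub>2
    by (rule has_vector_derivative_transform_within_open[OF that(1) assms(1,2)]) (simp add: that(2))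
  have "((snd \<kappa> \<circ> \<gamma>) has_vector_derivative d) (at t) \<longleftrightarrow> ((snd \<kappa> \<circ> \<gamma>') has_vector_derivative d) (at t)"
    for d and \<kappa> :: "('a, 'b) chart"
    by (intro iffI; erule *) (simp_all add: assms(3))
  then show ?thesis
    using assms(2,3) by (simp add: velocity_def vector_derivative_def)
qed

lemma speed_cong:
  assumes "open T" "t \<in> T" "\<And>s. s \<in> T \<Longrightarrow> \<gamma> s = \<gamma>' s"
  shows "speed M \<gamma> t = speed M \<gamma>' t"
  using assms(2,3) by (simp add: speed_def velocity_cong[of T t \<gamma> \<gamma>' M, OF assms])

lemma pw_C1_on_subinterval:
  assumes "pw_C1_on M l u \<gamma>" "l \<le> l'" "u' \<le> u"
  shows "pw_C1_on M l' u' \<gamma>"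
proof -
  obtain S where "finite S" "C1_off M l u \<gamma> S"
    using assms(1) by (rule pw_C1_onE)
  moreover have "continuous_on {l'..u'} \<gamma>"
    by (rule continuous_on_subset[OF pw_C1_on_continuous[OF assms(1)]]) (use assms in auto)
  ultimately show ?thesis
    using assms(2,3) by (intro pw_C1_onI[of l' u' \<gamma> S]) (auto intro!: C1_offD[of M l u \<gamma> S])
qed

lemma pw_C1_on_cong:
  assumes "pw_C1_on M l u \<gamma>" and eq: "\<And>t. t \<in> {l..u} \<Longrightarrow> \<gamma>' t = \<gamma> t"
  shows "pw_C1_on M l u \<gamma>'"
proof -
  obtain S where S: "finite S" "C1_off M l u \<gamma> S"
    using assms(1) by (rule pw_C1_onE)
  show ?thesis
  proof (rule pw_C1_onI[OF _ S(1)])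
    show "continuous_on {l..u} \<gamma>'"
      using continuous_on_cong[OF refl eq, of "{l..u}"] pw_C1_on_continuous[OF assms(1)] by simp
    fix \<kappa> a b
    assume \<kappa>: "\<kappa> \<in> atlas M" and ab: "l \<le> a" "a < b" "b \<le> u" "{a<..<b} \<inter> S = {}"
      and im: "\<gamma>' ` {a..b} \<subseteq> fst \<kappa>"
    have "\<gamma> ` {a..b} = \<gamma>' ` {a..b}"
      using ab by (intro image_cong) (auto simp: eq)
    then obtain d where "continuous_on {a..b} d"
      and d: "\<forall>t\<in>{a..b}. ((snd \<kappa> \<circ> \<gamma>) has_vector_derivative d t) (at t within {a..b})"
      using C1_offD[OF S(2) \<kappa> ab] im unfolding C1_in_chart_def by auto
    moreover have "((snd \<kappa> \<circ> \<gamma>') has_vector_derivative d t) (at t within {a..b})" if "t \<in> {a..b}" for t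
      by (rule has_vector_derivative_transform[OF that _ d[rule_format, OF that]])
        (use ab eq in auto)
    ultimately show "C1_in_chart \<kappa> \<gamma>' a b"
      unfolding C1_in_chart_def by blast
  qed
qed

lemma pw_C1_on_combine:
  assumes "pw_C1_on M l m \<gamma>" "pw_C1_on M m u \<gamma>" "l \<le> m" "m \<le> u"
  shows "pw_C1_on M l u \<gamma>"
proof -
  obtain S where S: "finite S" "C1_off M l m \<gamma> S"
    using assms(1) by (rule pw_C1_onE)
  obtain S' where S': "finite S'" "C1_off M m u \<gamma> S'"
    using assms(2) by (rule pw_C1_onE)
  \<comment> \<open>The junction \<open>m\<close> becomes a breakpoint, since the one-sided
    derivatives of the two pieces need not match there. Every admissible interval then lies on one
    side of it.\<close>
  show ?thesis
  proof (rule pw_C1_onI[of _ _ _ "S \<union> S' \<union> {m}"])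
    have "{l..u} = {l..m} \<union> {m..u}"
      using assms by auto
    then show "continuous_on {l..u} \<gamma>"
      using assms(1,2) by (simp add: continuous_on_closed_Un pw_C1_on_continuous)
    fix \<kappa> a b
    assume \<kappa>: "\<kappa> \<in> atlas M" and ab: "l \<le> a" "a < b" "b \<le> u" "{a<..<b} \<inter> (S \<union> S' \<union> {m}) = {}"
      and im: "\<gamma> ` {a..b} \<subseteq> fst \<kappa>"
    have "b \<le> m \<or> m \<le> a"
      using ab by force
    then show "C1_in_chart \<kappa> \<gamma> a b"
      using C1_offD[OF S(2) \<kappa>, of a b] C1_offD[OF S'(2) \<kappa>, of a b] ab im by auto
  qed (use S S' in auto)
qed

lemma pw_C1_on_affine:
  assumes \<gamma>: "pw_C1_on M l u \<gamma>" and m: "m \<noteq> 0" and lu': "l' \<le> u'"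
    and im: "(\<lambda>t. m * t + q) ` {l'..u'} = {l..u}"
  shows "pw_C1_on M l' u' (\<lambda>t. \<gamma> (m * t + q))"
proof -
  let ?h = "\<lambda>t. m * t + q"
  obtain S where fin: "finite S" and S: "C1_off M l u \<gamma> S"
    using \<gamma> by (rule pw_C1_onE)
  have inj: "inj ?h"
    using m by (auto simp: inj_on_def)
  show ?thesis
  proof (rule pw_C1_onI[OF _ finite_vimageI[OF fin inj]])
    show "continuous_on {l'..u'} (\<lambda>t. \<gamma> (m * t + q))"
      by (rule continuous_on_compose2[OF pw_C1_on_continuous[OF \<gamma>]])
        (simp_all add: im continuous_intros)
    fix \<kappa> a b
    assume \<kappa>: "\<kappa> \<in> atlas M"
      and ab: "l' \<le> a" "a < b" "b \<le> u'" "{a<..<b} \<inter> (?h -` S) = {}" "(\<lambda>t. \<gamma> (?h t)) ` {a..b} \<subseteq> fst \<kappa>"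
    \<comment> \<open>For negative \<open>m\<close> the map swaps the end points; this case provides
      reversed curves.\<close>
    define A where "A = min (?h a) (?h b)"
    define B where "B = max (?h a) (?h b)"
    have AB: "A < B"
      using ab m by (auto simp: A_def B_def min_def max_def)
    have img: "?h ` {a..b} = {A..B}"
      using ab m mult_le_cancel_left[of m a b]
      by (subst image_affinity_atLeastAtMost) (auto simp: A_def B_def min_def max_def)
    have "{A..B} \<subseteq> {l..u}"
      unfolding img[symmetric] im[symmetric] using ab by (intro image_mono) auto
    then have "l \<le> A" "B \<le> u"
      using AB by auto
    moreover have "{A<..<B} \<inter> S = {}"
    proof (rule equals0I)
      fix z assume z: "z \<in> {A<..<B} \<inter> S"
      then have "z \<in> {A..B}"
        by auto
      then obtain t where t: "t \<in> {a..b}" "z = ?h t"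
        unfolding img[symmetric] by auto
      then have "t \<noteq> a" "t \<noteq> b"
        using z by (auto simp: A_def B_def)
      then have "t \<in> {a<..<b} \<inter> ?h -` S"
        using t z by auto
      then show False
        using ab by auto
    qed
    moreover have "\<gamma> ` {A..B} \<subseteq> fst \<kappa>"
      using ab unfolding img[symmetric] by auto
    ultimately have "C1_in_chart \<kappa> \<gamma> A B"
      using AB by (intro C1_offD[OF S \<kappa>])
    then obtain d where d: "continuous_on {A..B} d"
      and D: "\<forall>t\<in>{A..B}. ((snd \<kappa> \<circ> \<gamma>) has_vector_derivative d t) (at t within {A..B})"
      unfolding C1_in_chart_def by blast
    have "continuous_on {a..b} (\<lambda>t. m *\<^sub>R d (?h t))"
      by (intro continuous_on_scaleR continuous_on_const continuous_on_compose2[OF d])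
        (simp_all add: img continuous_intros)
    moreover have "((snd \<kappa> \<circ> (\<lambda>t. \<gamma> (?h t))) has_vector_derivative m *\<^sub>R d (?h t)) (at t within {a..b})"
      if "t \<in> {a..b}" for t
    proof -
      have "(?h has_vector_derivative m) (at t within {a..b})"
        by (auto intro!: derivative_eq_intros simp: has_real_derivative_iff_has_vector_derivative[symmetric])
      moreover have "((snd \<kappa> \<circ> \<gamma>) has_vector_derivative d (?h t)) (at (?h t) within ?h ` {a..b})"
        using D[rule_format, of "?h t"] that unfolding img[symmetric] by blast
      ultimately show ?thesis
        by (drule_tac vector_diff_chain_within) (simp_all add: o_def)
    qed
    ultimately show "C1_in_chart \<kappa> (\<lambda>t. \<gamma> (m * t + q)) a b"
      unfolding C1_in_chart_def by blast
  qed
qed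

section \<open>Charts, tangent vectors and the metric at a point\<close>

locale connected_riemannian =
  fixes M :: "('a::{t2_space,second_countable_topology}, 'n::finite) riem"
  assumes manifold: "riemannian_manifold M"
    and connected: "connected (UNIV :: 'a set)"
begin

lemma chart_at: "chart_at M x \<in> atlas M" "x \<in> fst (chart_at M x)"
  using manifold by (auto simp: riemannian_manifold_def smooth_manifold_def)

lemma is_chart: "\<kappa> \<in> atlas M \<Longrightarrow> is_chart \<kappa>"
  using manifold by (auto simp: riemannian_manifold_def smooth_manifold_def)

lemma chart_open:
  assumes "\<kappa> \<in> atlas M"
  shows "open (fst \<kappa>)" "open (chart_image \<kappa>)"
  using is_chart[OF assms] by (auto simp: is_chart_def)

lemma chart_continuous:
  assumes "\<kappa> \<in> atlas M"
  shows "continuous_on (fst \<kappa>) (snd \<kappa>)" "continuous_on (chart_image \<kappa>) (chart_inv \<kappa>)"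
  using is_chart[OF assms] by (auto simp: is_chart_def homeomorphism_def)

lemma chart_inverse:
  assumes "\<kappa> \<in> atlas M"
  shows "y \<in> fst \<kappa> \<Longrightarrow> snd \<kappa> y \<in> chart_image \<kappa>"
    and "y \<in> fst \<kappa> \<Longrightarrow> chart_inv \<kappa> (snd \<kappa> y) = y"
    and "p \<in> chart_image \<kappa> \<Longrightarrow> chart_inv \<kappa> p \<in> fst \<kappa>"
    and "p \<in> chart_image \<kappa> \<Longrightarrow> snd \<kappa> (chart_inv \<kappa> p) = p"
proof -
  have h: "homeomorphism (fst \<kappa>) (chart_image \<kappa>) (snd \<kappa>) (chart_inv \<kappa>)"
    using is_chart[OF assms] by (simp add: is_chart_def)
  show "y \<in> fst \<kappa> \<Longrightarrow> snd \<kappa> y \<in> chart_image \<kappa>"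
    by (simp add: chart_image_def)
  show "y \<in> fst \<kappa> \<Longrightarrow> chart_inv \<kappa> (snd \<kappa> y) = y"
    by (rule homeomorphism_apply1[OF h])
  show "p \<in> chart_image \<kappa> \<Longrightarrow> snd \<kappa> (chart_inv \<kappa> p) = p"
    by (rule homeomorphism_apply2[OF h])
  show "p \<in> chart_image \<kappa> \<Longrightarrow> chart_inv \<kappa> p \<in> fst \<kappa>"
    using homeomorphism_image2[OF h] by blast
qed

lemma isCont_chart:
  assumes "\<kappa> \<in> atlas M" "y \<in> fst \<kappa>"
  shows "isCont (snd \<kappa>) y"
  using chart_continuous(1)[OF assms(1)] chart_open(1)[OF assms(1)] assms(2)
  by (simp add: continuous_on_eq_continuous_at)

lemma isCont_chart_inv:
  assumes "\<kappa> \<in> atlas M" "p \<in> chart_image \<kappa>"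
  shows "isCont (chart_inv \<kappa>) p"
  using chart_continuous(2)[OF assms(1)] chart_open(2)[OF assms(1)] assms(2)
  by (simp add: continuous_on_eq_continuous_at)

lemma chart_image_Int:
  assumes "\<kappa> \<in> atlas M"
  shows "snd \<kappa> ` (A \<inter> fst \<kappa>) = {p \<in> chart_image \<kappa>. chart_inv \<kappa> p \<in> A}"
proof (intro equalityI subsetI)
  fix p assume "p \<in> {p \<in> chart_image \<kappa>. chart_inv \<kappa> p \<in> A}"
  then show "p \<in> snd \<kappa> ` (A \<inter> fst \<kappa>)"
    using chart_inverse(3,4)[OF assms, of p] by (intro image_eqI[of _ _ "chart_inv \<kappa> p"]) auto
qed (auto simp: chart_inverse[OF assms])

lemma transition_smooth:
  assumes "\<kappa> \<in> atlas M" "\<kappa>' \<in> atlas M"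
  shows "smooth_on {p \<in> chart_image \<kappa>. chart_inv \<kappa> p \<in> fst \<kappa>'} (snd \<kappa>' \<circ> chart_inv \<kappa>)"
proof -
  have "smooth_on (snd \<kappa> ` (fst \<kappa> \<inter> fst \<kappa>')) (snd \<kappa>' \<circ> chart_inv \<kappa>)"
    using manifold assms unfolding riemannian_manifold_def smooth_manifold_def by blast
  then show ?thesis
    using chart_image_Int[OF assms(1), of "fst \<kappa>'"] by (simp add: Int_commute)
qed

lemma transition_has_derivative:
  assumes "\<kappa> \<in> atlas M" "\<kappa>' \<in> atlas M" "y \<in> fst \<kappa>" "y \<in> fst \<kappa>'"
  shows "((snd \<kappa>' \<circ> chart_inv \<kappa>) has_derivative frechet_derivative (snd \<kappa>' \<circ> chart_inv \<kappa>) (at (snd \<kappa> y)))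
     (at (snd \<kappa> y))"
  using assms chart_inverse[OF assms(1)] by (intro smooth_on_has_derivative[OF transition_smooth]) auto

lemma tvec_linear:
  assumes "\<kappa> \<in> atlas M" "y \<in> fst \<kappa>"
  shows "linear (tvec M \<kappa> y)"
  using has_derivative_linear[OF transition_has_derivative[OF assms(1) chart_at(1) assms(2) chart_at(2)]]
  by (simp add: tvec_def[abs_def])

lemma tvec_chart_at: "tvec M (chart_at M y) y = id"
proof -
  let ?\<kappa> = "chart_at M y"
  have "((\<lambda>p. p) has_derivative (\<lambda>p. p)) (at (snd ?\<kappa> y))"
    by (rule has_derivative_ident)
  then have "((snd ?\<kappa> \<circ> chart_inv ?\<kappa>) has_derivative (\<lambda>p. p)) (at (snd ?\<kappa> y))"
    using chart_at chart_inverse[OF chart_at(1)] chart_open[OF chart_at(1)]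
    by (elim has_derivative_transform_within_open[where s = "chart_image ?\<kappa>"]) auto
  from frechet_derivative_at[OF this] show ?thesis
    by (simp add: tvec_def[abs_def] fun_eq_iff)
qed

text \<open>The chain rule through the transition map. Continuity of \<open>\<phi>\<close> is a
  separate assumption because \<open>snd \<kappa>\<close> has arbitrary values outside its domain:
  differentiability of \<open>snd \<kappa> \<circ> \<phi>\<close> at \<open>u\<close> does not keep
  \<open>\<phi>\<close> inside \<open>fst \<kappa>\<close> near \<open>u\<close>.\<close>

lemma change_chart:
  fixes \<phi> :: "'b::real_normed_vector \<Rightarrow> 'a"
  assumes \<kappa>: "\<kappa> \<in> atlas M" "\<kappa>' \<in> atlas M" "\<phi> u \<in> fst \<kappa>" "\<phi> u \<in> fst \<kappa>'" and c: "isCont \<phi> u"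
    and D: "((snd \<kappa> \<circ> \<phi>) has_derivative D) (at u)"
  shows "((snd \<kappa>' \<circ> \<phi>) has_derivative
    (\<lambda>w. frechet_derivative (snd \<kappa>' \<circ> chart_inv \<kappa>) (at (snd \<kappa> (\<phi> u))) (D w))) (at u)"
proof -
  have "((snd \<kappa>' \<circ> chart_inv \<kappa>) \<circ> (snd \<kappa> \<circ> \<phi>) has_derivative
    frechet_derivative (snd \<kappa>' \<circ> chart_inv \<kappa>) (at (snd \<kappa> (\<phi> u))) \<circ> D) (at u)"
    using transition_has_derivative[OF \<kappa>] by (intro diff_chain_at[OF D]) auto
  moreover have "\<forall>\<^sub>F v in at u. \<phi> v \<in> fst \<kappa>"
    using c chart_open(1)[OF \<kappa>(1)] \<kappa>(3) unfolding isCont_def by (rule topological_tendstoD)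
  then have "\<forall>\<^sub>F v in at u. ((snd \<kappa>' \<circ> chart_inv \<kappa>) \<circ> (snd \<kappa> \<circ> \<phi>)) v = (snd \<kappa>' \<circ> \<phi>) v"
    by eventually_elim (simp add: chart_inverse[OF \<kappa>(1)])
  ultimately have "((snd \<kappa>' \<circ> \<phi>) has_derivative
    frechet_derivative (snd \<kappa>' \<circ> chart_inv \<kappa>) (at (snd \<kappa> (\<phi> u))) \<circ> D) (at u)"
    by (rule has_derivative_transform_eventually) (simp_all add: chart_inverse[OF \<kappa>(1)] \<kappa>)
  then show ?thesis
    by (simp add: o_def)
qed

text \<open>The chart used by \<open>velocity\<close> may jump with \<open>\<gamma> t\<close>.
  Regularity in \<open>t\<close> can only be discussed after passing to a fixed chart
  \<open>\<kappa>\<close>.\<close>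

lemma velocity_in_chart:
  assumes "\<kappa> \<in> atlas M" "\<gamma> t \<in> fst \<kappa>" "isCont \<gamma> t"
    and "((snd \<kappa> \<circ> \<gamma>) has_vector_derivative d) (at t)"
  shows "((snd (chart_at M (\<gamma> t)) \<circ> \<gamma>) has_vector_derivative tvec M \<kappa> (\<gamma> t) d) (at t)"
    and "velocity M \<gamma> t = tvec M \<kappa> (\<gamma> t) d"
proof -
  have "((snd (chart_at M (\<gamma> t)) \<circ> \<gamma>) has_derivative (\<lambda>h. tvec M \<kappa> (\<gamma> t) (h *\<^sub>R d))) (at t)"
    using change_chart[OF assms(1) chart_at(1) assms(2) chart_at(2) assms(3)] assms(4)
    unfolding has_vector_derivative_def by (simp add: tvec_def)
  then show "((snd (chart_at M (\<gamma> t)) \<circ> \<gamma>) has_vector_derivative tvec M \<kappa> (\<gamma> t) d) (at t)"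
    unfolding has_vector_derivative_def
    by (simp add: linear_cmul[OF tvec_linear[OF assms(1,2)]])
  then show "velocity M \<gamma> t = tvec M \<kappa> (\<gamma> t) d"
    unfolding velocity_def by (rule vector_derivative_at)
qed

lemma metric_bilinear: "bilinear (metric M y)"
  and metric_sym: "metric M y v w = metric M y w v"
  and metric_pos: "v \<noteq> 0 \<Longrightarrow> metric M y v v > 0"
  using manifold by (auto simp: riemannian_manifold_def)

lemma metric_nonneg: "metric M y v v \<ge> 0"
  using metric_pos[of v y] bilinear_lzero[OF metric_bilinear[of y]] by (cases "v = 0") auto

lemma tnorm_nonneg [simp]: "tnorm M y v \<ge> 0"
  using metric_nonneg by (simp add: tnorm_def)

lemma tnorm_square: "(tnorm M y v)\<^sup>2 = metric M y v v"
  using metric_nonneg by (simp add: tnorm_def)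

lemma tnorm_0 [simp]: "tnorm M y 0 = 0"
  using bilinear_lzero[OF metric_bilinear[of y]] by (simp add: tnorm_def)

lemma tnorm_eq_0: "tnorm M y v = 0 \<longleftrightarrow> v = 0"
  using metric_pos[of v y] tnorm_0[of y] by (cases "v = 0") (auto simp: tnorm_def)

lemma tnorm_scaleR: "tnorm M y (a *\<^sub>R v) = \<bar>a\<bar> * tnorm M y v"
proof -
  have "metric M y (a *\<^sub>R v) (a *\<^sub>R v) = a\<^sup>2 * metric M y v v"
    using bilinear_lmul[OF metric_bilinear] bilinear_rmul[OF metric_bilinear]
    by (simp add: power2_eq_square)
  then show ?thesis
    by (simp add: tnorm_def real_sqrt_mult)
qed

lemma metric_Cauchy_Schwarz: "metric M y v w \<le> tnorm M y v * tnorm M y w"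
proof (cases "w = 0")
  case True
  then show ?thesis
    using bilinear_rzero[OF metric_bilinear] by simp
next
  case False
  let ?g = "metric M y"
  note bl = bilinear_lsub[OF metric_bilinear] bilinear_rsub[OF metric_bilinear]
    bilinear_lmul[OF metric_bilinear] bilinear_rmul[OF metric_bilinear]
  have p: "?g w w > 0"
    using metric_pos[OF False] .
  define a where "a = ?g v w / ?g w w"
  have "0 \<le> ?g (v - a *\<^sub>R w) (v - a *\<^sub>R w)"
    by (rule metric_nonneg)
  also have "\<dots> = ?g v v - 2 * a * ?g v w + a\<^sup>2 * ?g w w"
    using metric_sym[of y w v] by (simp add: bl power2_eq_square algebra_simps)
  also have "\<dots> = ?g v v - (?g v w)\<^sup>2 / ?g w w"
    using p by (simp add: a_def power2_eq_square field_simps)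
  finally have "(?g v w)\<^sup>2 \<le> ?g v v * ?g w w"
    using p by (simp add: field_simps)
  then have "\<bar>?g v w\<bar> \<le> sqrt (?g v v * ?g w w)"
    using real_le_rsqrt[of "\<bar>?g v w\<bar>"] by simp
  then show ?thesis
    by (simp add: tnorm_def real_sqrt_mult)
qed

end

section \<open>Lengths of piecewise continuously differentiable curves\<close>

context connected_riemannian
begin

lemma metric_coefficient_continuous:
  assumes "\<kappa> \<in> atlas M"
  shows "continuous_on (chart_image \<kappa>)
    (\<lambda>p. metric M (chart_inv \<kappa> p) (tvec M \<kappa> (chart_inv \<kappa> p) v) (tvec M \<kappa> (chart_inv \<kappa> p) w))"
  using manifold assms unfolding riemannian_manifold_def by (intro smooth_onD(1)) blast

text \<open>Smoothness of the metric is given only for its coefficients on fixed coordinate vectors.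
  Expanding in the basis makes the norm of a varying vector \<open>d\<close> a continuous expression
  in these coefficients and the coordinates of \<open>d\<close>.\<close>

lemma tnorm_tvec_expand:
  assumes "\<kappa> \<in> atlas M" "y \<in> fst \<kappa>"
  shows "tnorm M y (tvec M \<kappa> y d) =
    sqrt (\<Sum>(i, j)\<in>Basis \<times> Basis. (d \<bullet> i) * (d \<bullet> j) * metric M y (tvec M \<kappa> y i) (tvec M \<kappa> y j))"
proof -
  have "tvec M \<kappa> y d = tvec M \<kappa> y (\<Sum>i\<in>Basis. (d \<bullet> i) *\<^sub>R i)"
    by (simp add: euclidean_representation)
  also have "\<dots> = (\<Sum>i\<in>Basis. (d \<bullet> i) *\<^sub>R tvec M \<kappa> y i)"
    using tvec_linear[OF assms] by (simp add: linear_sum linear_cmul)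
  finally have "metric M y (tvec M \<kappa> y d) (tvec M \<kappa> y d) =
    (\<Sum>(i, j)\<in>Basis \<times> Basis. metric M y ((d \<bullet> i) *\<^sub>R tvec M \<kappa> y i) ((d \<bullet> j) *\<^sub>R tvec M \<kappa> y j))"
    by (simp add: bilinear_sum[OF metric_bilinear])
  also have "\<dots> = (\<Sum>(i, j)\<in>Basis \<times> Basis. (d \<bullet> i) * (d \<bullet> j) * metric M y (tvec M \<kappa> y i) (tvec M \<kappa> y j))"
    by (intro sum.cong refl)
      (auto simp: bilinear_lmul[OF metric_bilinear] bilinear_rmul[OF metric_bilinear])
  finally show ?thesis
    by (simp add: tnorm_def)
qed

lemma C1_in_chart_has_derivative:
  assumes "C1_in_chart \<kappa> \<gamma> a b" "t \<in> {a<..<b}"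
  shows "\<exists>d. ((snd \<kappa> \<circ> \<gamma>) has_vector_derivative d) (at t)"
proof -
  have "at t within {a..b} = at t"
    by (rule at_within_Icc_at) (use assms in auto)
  then show ?thesis
    using assms(1)[unfolded C1_in_chart_def] greaterThanLessThan_subseteq_atLeastAtMost_iff[of a b a b] assms(2)
    by (metis order_refl subsetD)
qed

lemma C1_in_chart_speed:
  assumes \<kappa>: "\<kappa> \<in> atlas M" and C1: "C1_in_chart \<kappa> \<gamma> a b" and c: "continuous_on {a..b} \<gamma>"
    and im: "\<gamma> ` {a..b} \<subseteq> fst \<kappa>"
  shows "speed M \<gamma> integrable_on {a..b}"
proof -
  obtain d where d: "continuous_on {a..b} d"
    and D: "\<And>t. t\<in>{a..b} \<Longrightarrow> ((snd \<kappa> \<circ> \<gamma>) has_vector_derivative d t) (at t within {a..b})"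
    using C1 unfolding C1_in_chart_def by blast
  \<comment> \<open>The speed rewritten in the fixed chart, as a composition of continuous
    functions. The two agree off the end points only, because \<open>velocity\<close> is a two-sided
    derivative.\<close>
  define \<sigma> where "\<sigma> t = sqrt (\<Sum>(i, j)\<in>Basis \<times> Basis. (d t \<bullet> i) * (d t \<bullet> j) *
      metric M (chart_inv \<kappa> (snd \<kappa> (\<gamma> t))) (tvec M \<kappa> (chart_inv \<kappa> (snd \<kappa> (\<gamma> t))) i)
        (tvec M \<kappa> (chart_inv \<kappa> (snd \<kappa> (\<gamma> t))) j))" for t
  have k: "continuous_on {a..b} (\<lambda>t. snd \<kappa> (\<gamma> t))"
    by (rule continuous_on_compose2[OF chart_continuous(1)[OF \<kappa>] c im])
  have sub: "(\<lambda>t. snd \<kappa> (\<gamma> t)) ` {a..b} \<subseteq> chart_image \<kappa>"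
    using im chart_inverse(1)[OF \<kappa>] by blast
  have "continuous_on {a..b} \<sigma>"
    unfolding \<sigma>_def case_prod_beta
    by (intro continuous_intros d continuous_on_compose2[OF metric_coefficient_continuous[OF \<kappa>] k sub])
  then have "\<sigma> integrable_on {a..b}"
    by (rule integrable_continuous_interval)
  then show ?thesis
  proof (rule integrable_spike_finite[of "{a, b}", rotated 2])
    fix t assume t: "t \<in> {a..b} - {a, b}"
    then have w: "at t within {a..b} = at t"
      by (intro at_within_Icc_at) auto
    have tk: "\<gamma> t \<in> fst \<kappa>"
      using t im by auto
    have "velocity M \<gamma> t = tvec M \<kappa> (\<gamma> t) (d t)"
    proof (rule velocity_in_chart(2)[of \<kappa> \<gamma> t, OF \<kappa> tk])
      show "isCont \<gamma> t"
        using c t w by (metis DiffD1 continuous_on_eq_continuous_within)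
      show "((snd \<kappa> \<circ> \<gamma>) has_vector_derivative d t) (at t)"
        using D[of t] t w by simp
    qed
    then show "speed M \<gamma> t = \<sigma> t"
      by (simp add: speed_def \<sigma>_def tnorm_tvec_expand[OF \<kappa> tk] chart_inverse(2)[OF \<kappa> tk])
  qed simp
qed

text \<open>Near \<open>t\<close> the only possible breakpoint is \<open>t\<close> itself, by
  finiteness of \<open>S\<close>. The condition on \<open>S \<inter> {t}\<close> admits intervals
  that end at \<open>t\<close> even if \<open>t\<close> is a breakpoint.\<close>

lemma pw_C1_on_local_chart:
  assumes \<gamma>: "pw_C1_on M l u \<gamma>" and S: "finite S" "C1_off M l u \<gamma> S"
    and \<kappa>: "\<kappa> \<in> atlas M" and t: "t \<in> {l..u}" "\<gamma> t \<in> fst \<kappa>"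
  obtains e where "e > 0" "\<And>a b. l \<le> a \<Longrightarrow> b \<le> u \<Longrightarrow> a < b \<Longrightarrow> t - e < a \<Longrightarrow> b < t + e \<Longrightarrow>
    {a<..<b} \<inter> (S \<inter> {t}) = {} \<Longrightarrow> C1_in_chart \<kappa> \<gamma> a b \<and> \<gamma> ` {a..b} \<subseteq> fst \<kappa>"
proof -
  have "(\<gamma> \<longlongrightarrow> \<gamma> t) (at t within {l..u})"
    using pw_C1_on_continuous[OF \<gamma>] t by (simp add: continuous_on_def)
  then have "\<forall>\<^sub>F s in at t within {l..u}. \<gamma> s \<in> fst \<kappa>"
    using chart_open(1)[OF \<kappa>] t(2) by (rule topological_tendstoD)
  then obtain e1 where e1: "e1 > 0" "\<And>s. s \<in> {l..u} \<Longrightarrow> s \<noteq> t \<Longrightarrow> dist s t < e1 \<Longrightarrow> \<gamma> s \<in> fst \<kappa>"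
    unfolding eventually_at by auto
  have "open (- (S - {t}))"
    using S(1) by (intro open_Compl finite_imp_closed) auto
  then obtain e2 where e2: "e2 > 0" "ball t e2 \<subseteq> - (S - {t})"
    by (meson ComplI DiffD2 insertI1 open_contains_ball)
  show ?thesis
  proof (rule that[of "min e1 e2"])
    fix a b assume ab: "l \<le> a" "b \<le> u" "a < b" "t - min e1 e2 < a" "b < t + min e1 e2"
      and d: "{a<..<b} \<inter> (S \<inter> {t}) = {}"
    have in1: "s \<in> {l..u}" "dist s t < e1" "dist s t < e2" if "s \<in> {a..b}" for s
      using ab that by (auto simp: dist_real_def)
    have im: "\<gamma> ` {a..b} \<subseteq> fst \<kappa>"
    proof (rule image_subsetI)
      fix s assume "s \<in> {a..b}"
      then show "\<gamma> s \<in> fst \<kappa>"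
        using e1(2)[of s] in1[of s] t(2) by (cases "s = t") auto
    qed
    moreover have "{a<..<b} \<inter> S = {}"
    proof (rule equals0I)
      fix s assume s: "s \<in> {a<..<b} \<inter> S"
      then have "s \<in> ball t e2"
        using in1(3)[of s] by (auto simp: dist_commute)
      then show False
        using e2(2) s d by auto
    qed
    ultimately show "C1_in_chart \<kappa> \<gamma> a b \<and> \<gamma> ` {a..b} \<subseteq> fst \<kappa>"
      using C1_offD[OF S(2) \<kappa>] ab by blast
  qed (use e1 e2 in auto)
qed

lemma pw_C1_on_differentiable:
  assumes \<gamma>: "pw_C1_on M l u \<gamma>"
  obtains S where "finite S"
    "\<And>t \<kappa>. t \<in> {l<..<u} - S \<Longrightarrow> \<kappa> \<in> atlas M \<Longrightarrow> \<gamma> t \<in> fst \<kappa> \<Longrightarrow>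
      \<exists>d. ((snd \<kappa> \<circ> \<gamma>) has_vector_derivative d) (at t)"
proof -
  obtain S where S: "finite S" "C1_off M l u \<gamma> S"
    using \<gamma> by (rule pw_C1_onE)
  show ?thesis
  proof (rule that[OF S(1)])
    fix t \<kappa> assume t: "t \<in> {l<..<u} - S" and \<kappa>: "\<kappa> \<in> atlas M" "\<gamma> t \<in> fst \<kappa>"
    then obtain e where e: "e > 0" "\<And>a b. l \<le> a \<Longrightarrow> b \<le> u \<Longrightarrow> a < b \<Longrightarrow> t - e < a \<Longrightarrow> b < t + e \<Longrightarrow>
        {a<..<b} \<inter> (S \<inter> {t}) = {} \<Longrightarrow> C1_in_chart \<kappa> \<gamma> a b \<and> \<gamma> ` {a..b} \<subseteq> fst \<kappa>"
      using pw_C1_on_local_chart[OF \<gamma> S \<kappa>(1), of t] by auto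
    have "C1_in_chart \<kappa> \<gamma> (max l (t - e/2)) (min u (t + e/2))"
      using e(2)[of "max l (t - e/2)" "min u (t + e/2)"] t e(1) by auto
    then show "\<exists>d. ((snd \<kappa> \<circ> \<gamma>) has_vector_derivative d) (at t)"
      by (rule C1_in_chart_has_derivative) (use t e(1) in auto)
  qed
qed

lemma pw_C1_on_isCont:
  assumes "pw_C1_on M l u \<gamma>" "t \<in> {l<..<u}"
  shows "isCont \<gamma> t"
  using continuous_on_interior[OF pw_C1_on_continuous[OF assms(1)], of t] assms(2) by simp

lemma speed_integrable:
  assumes \<gamma>: "pw_C1_on M l u \<gamma>"
  shows "speed M \<gamma> integrable_on {l..u}"
proof (cases "l \<le> u")
  case True
  obtain S where S: "finite S" "C1_off M l u \<gamma> S"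
    using \<gamma> by (rule pw_C1_onE)
  \<comment> \<open>Bisection replaces a subdivision into charts: integrability passes to
    concatenated intervals and holds near each point. The induction predicate ranges over all
    intervals and so carries a guard, which is trivial for \<open>{l..u}\<close> itself.\<close>
  have "l \<le> l \<and> u \<le> u \<longrightarrow> speed M \<gamma> integrable_on {l..u}"
    using True
  proof (induction rule: Bolzano[where P = "\<lambda>a b. l \<le> a \<and> b \<le> u \<longrightarrow> speed M \<gamma> integrable_on {a..b}"])
    case (trans a b c)
    then show ?case
      using Henstock_Kurzweil_Integration.integrable_combine[of a b c "speed M \<gamma>"] by auto
  next
    case (local t)
    let ?\<kappa> = "chart_at M (\<gamma> t)"
    obtain e where e: "e > 0" "\<And>a b. l \<le> a \<Longrightarrow> b \<le> u \<Longrightarrow> a < b \<Longrightarrow> t - e < a \<Longrightarrow> b < t + e \<Longrightarrow>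
        {a<..<b} \<inter> (S \<inter> {t}) = {} \<Longrightarrow> C1_in_chart ?\<kappa> \<gamma> a b \<and> \<gamma> ` {a..b} \<subseteq> fst ?\<kappa>"
      using pw_C1_on_local_chart[OF \<gamma> S chart_at(1), of t "\<gamma> t"] local chart_at(2) by auto
    have int: "speed M \<gamma> integrable_on {a..b}"
      if "l \<le> a" "b \<le> u" "a \<le> b" "t - e < a" "b < t + e" "t \<notin> {a<..<b}" for a b
    proof (cases "a = b")
      case True
      then show ?thesis
        using integrable_on_refl[of "speed M \<gamma>" a] by simp
    next
      case False
      then have "C1_in_chart ?\<kappa> \<gamma> a b \<and> \<gamma> ` {a..b} \<subseteq> fst ?\<kappa>"
        using that by (intro e(2)) auto
      moreover have "continuous_on {a..b} \<gamma>"
        by (rule continuous_on_subset[OF pw_C1_on_continuous[OF \<gamma>]]) (use that in auto)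
      ultimately show ?thesis
        using C1_in_chart_speed[OF chart_at(1)] by blast
    qed
    \<comment> \<open>Splitting at \<open>t\<close> leaves two intervals without a breakpoint in
      their interior.\<close>
    have "l \<le> a \<and> b \<le> u \<longrightarrow> speed M \<gamma> integrable_on {a..b}" if "a \<le> t \<and> t \<le> b \<and> b - a < e" for a b
      using int[of a t] int[of t b] that Henstock_Kurzweil_Integration.integrable_combine[of a t b "speed M \<gamma>"] by auto
    then show ?case
      using e(1) by blast
  qed
  then show ?thesis
    by simp
qed (simp add: integrable_on_empty)

lemma speed_nonneg: "speed M \<gamma> t \<ge> 0"
  by (simp add: speed_def)

text \<open>The factor \<open>\<bar>m\<bar>\<close> from the chain rule cancels
  \<open>1 / \<bar>m\<bar>\<close> from the substitution in the integral. The absolute value covers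
  the reversal of a curve.\<close>

lemma speed_affine:
  assumes \<gamma>: "pw_C1_on M l u \<gamma>" and m: "m \<noteq> 0" and lu': "l' \<le> u'"
    and im: "(\<lambda>t. m * t + q) ` {l'..u'} = {l..u}"
  shows "integral {l'..u'} (speed M (\<lambda>t. \<gamma> (m * t + q))) = integral {l..u} (speed M \<gamma>)"
proof -
  let ?h = "\<lambda>t. m * t + q"
  have inj: "inj ?h"
    using m by (auto simp: inj_on_def)
  obtain S where S: "finite S"
    "\<And>t \<kappa>. t \<in> {l<..<u} - S \<Longrightarrow> \<kappa> \<in> atlas M \<Longrightarrow> \<gamma> t \<in> fst \<kappa> \<Longrightarrow>
      \<exists>d. ((snd \<kappa> \<circ> \<gamma>) has_vector_derivative d) (at t)"
    using pw_C1_on_differentiable[OF \<gamma>] by blast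
  define I where "I = integral {l..u} (speed M \<gamma>)"
  have I: "(speed M \<gamma> has_integral I) (cbox l u)"
    using speed_integrable[OF \<gamma>] by (simp add: I_def has_integral_iff)
  have "(\<lambda>x. (1 / m) *\<^sub>R x + - ((1 / m) *\<^sub>R q)) ` cbox l u = (\<lambda>x. (1 / m) *\<^sub>R x + - ((1 / m) *\<^sub>R q)) ` ?h ` {l'..u'}"
    by (simp add: im)
  also have "\<dots> = {l'..u'}"
    unfolding image_image using m by (simp add: field_simps)
  finally have "((\<lambda>t. speed M \<gamma> (?h t)) has_integral (1 / \<bar>m\<bar>) * I) {l'..u'}"
    using has_integral_affinity[OF I m, of q] by simp
  then have "((\<lambda>t. \<bar>m\<bar> * speed M \<gamma> (?h t)) has_integral \<bar>m\<bar> * ((1 / \<bar>m\<bar>) * I)) {l'..u'}"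
    by (rule has_integral_mult_right)
  then have *: "((\<lambda>t. \<bar>m\<bar> * speed M \<gamma> (?h t)) has_integral I) {l'..u'}"
    using m by simp
  have "(speed M (\<lambda>t. \<gamma> (?h t)) has_integral I) {l'..u'}"
  proof (rule has_integral_spike_finite[OF _ _ *])
    show "finite (?h -` (S \<union> {l, u}))"
      using S(1) by (intro finite_vimageI inj) auto
    fix t assume t: "t \<in> {l'..u'} - ?h -` (S \<union> {l, u})"
    then have "?h t \<in> {l..u}"
      unfolding im[symmetric] by blast
    then have ht: "?h t \<in> {l<..<u} - S"
      using t by auto
    let ?\<kappa> = "chart_at M (\<gamma> (?h t))"
    obtain d where d: "((snd ?\<kappa> \<circ> \<gamma>) has_vector_derivative d) (at (?h t))"
      using S(2)[OF ht chart_at] by blast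
    have "(?h has_vector_derivative m) (at t)"
      by (auto intro!: derivative_eq_intros simp: has_real_derivative_iff_has_vector_derivative[symmetric])
    from vector_diff_chain_at[OF this d]
    have "((snd ?\<kappa> \<circ> (\<lambda>t. \<gamma> (?h t))) has_vector_derivative m *\<^sub>R d) (at t)"
      by (simp add: o_def)
    then have "velocity M (\<lambda>t. \<gamma> (?h t)) t = m *\<^sub>R velocity M \<gamma> (?h t)"
      unfolding velocity_def using vector_derivative_at[OF d] by (simp add: vector_derivative_at)
    then show "speed M (\<lambda>t. \<gamma> (?h t)) t = \<bar>m\<bar> * speed M \<gamma> (?h t)"
      by (simp add: speed_def tnorm_scaleR)
  qed
  then show ?thesis
    by (simp add: I_def integral_unique)
qed

lemma curve_length_nonneg: "curve_length M \<gamma> \<ge> 0"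
proof (cases "speed M \<gamma> integrable_on {0..1}")
  case True
  then show ?thesis
    unfolding curve_length_eq by (intro integral_nonneg) (auto simp: speed_nonneg)
qed (simp add: curve_length_eq not_integrable_integral)

lemma rdist_le_curve_length:
  assumes "pw_C1_curve M \<gamma>" "\<gamma> 0 = y" "\<gamma> 1 = z"
  shows "rdist M y z \<le> curve_length M \<gamma>"
  unfolding rdist_def
  by (rule cINF_lower) (use assms curve_length_nonneg in \<open>auto intro!: bdd_belowI[of _ 0]\<close>)

lemma pw_C1_on_reparametrize:
  assumes \<gamma>: "pw_C1_on M l u \<gamma>" and "l < u"
  obtains \<gamma>' where "pw_C1_curve M \<gamma>'" "\<gamma>' 0 = \<gamma> l" "\<gamma>' 1 = \<gamma> u"
    "curve_length M \<gamma>' = integral {l..u} (speed M \<gamma>)"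
proof -
  have im: "(\<lambda>t. (u - l) * t + l) ` {0..1} = {l..u}"
    using assms(2) by (subst image_affinity_atLeastAtMost) auto
  show ?thesis
    using that[of "\<lambda>t. \<gamma> ((u - l) * t + l)"] pw_C1_on_affine[OF \<gamma> _ _ im] speed_affine[OF \<gamma> _ _ im] assms(2)
    by (simp add: pw_C1_curve_iff curve_length_eq)
qed

lemma pw_C1_curve_reverse:
  assumes \<gamma>: "pw_C1_curve M \<gamma>"
  obtains \<gamma>' where "pw_C1_curve M \<gamma>'" "\<gamma>' 0 = \<gamma> 1" "\<gamma>' 1 = \<gamma> 0" "curve_length M \<gamma>' = curve_length M \<gamma>"
proof -
  have im: "(\<lambda>t::real. (-1) * t + 1) ` {0..1} = {0..1}"
    by (subst image_affinity_atLeastAtMost) auto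
  have C1: "pw_C1_on M 0 1 \<gamma>"
    using \<gamma> by (simp add: pw_C1_curve_iff)
  show ?thesis
    using that[of "\<lambda>t. \<gamma> ((-1) * t + 1)"] pw_C1_on_affine[OF C1 _ _ im] speed_affine[OF C1 _ _ im]
    by (simp add: pw_C1_curve_iff curve_length_eq)
qed

lemma pw_C1_curve_join:
  assumes \<gamma>: "pw_C1_curve M \<gamma>\<^sub>1" "pw_C1_curve M \<gamma>\<^sub>2" "\<gamma>\<^sub>1 1 = \<gamma>\<^sub>2 0"
  obtains \<gamma> where "pw_C1_curve M \<gamma>" "\<gamma> 0 = \<gamma>\<^sub>1 0" "\<gamma> 1 = \<gamma>\<^sub>2 1"
    "curve_length M \<gamma> = curve_length M \<gamma>\<^sub>1 + curve_length M \<gamma>\<^sub>2"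
proof -
  \<comment> \<open>The join lives on \<open>{0..2}\<close> and is rescaled afterwards; the shift is
    spelled \<open>1 * t + (-1)\<close> to match the affine reparametrisation.\<close>
  define \<gamma> where "\<gamma> t = (if t \<le> 1 then \<gamma>\<^sub>1 t else \<gamma>\<^sub>2 (1 * t + (-1)))" for t
  have im: "(\<lambda>t::real. 1 * t + (-1)) ` {1..2} = {0..1}"
    by (subst image_affinity_atLeastAtMost) auto
  have \<gamma>01: "pw_C1_on M 0 1 \<gamma>\<^sub>1" "pw_C1_on M 0 1 \<gamma>\<^sub>2"
    using \<gamma> by (simp_all add: pw_C1_curve_iff)
  have l: "pw_C1_on M 0 1 \<gamma>"
    by (rule pw_C1_on_cong[OF \<gamma>01(1)]) (simp add: \<gamma>_def)
  have r: "pw_C1_on M 1 2 \<gamma>"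
    by (rule pw_C1_on_cong[OF pw_C1_on_affine[OF \<gamma>01(2) _ _ im]])
      (use \<gamma>(3) in \<open>auto simp: \<gamma>_def not_le\<close>)
  have C1: "pw_C1_on M 0 2 \<gamma>"
    by (rule pw_C1_on_combine[OF l r]) auto
  obtain \<gamma>' where \<gamma>': "pw_C1_curve M \<gamma>'" "\<gamma>' 0 = \<gamma> 0" "\<gamma>' 1 = \<gamma> 2"
    "curve_length M \<gamma>' = integral {0..2} (speed M \<gamma>)"
    using pw_C1_on_reparametrize[OF C1] by auto
  have "integral {0..2} (speed M \<gamma>) = integral {0..1} (speed M \<gamma>) + integral {1..2} (speed M \<gamma>)"
    using Henstock_Kurzweil_Integration.integral_combine[OF _ _ speed_integrable[OF C1], of 1] by simp
  \<comment> \<open>At \<open>t = 1\<close> the joined curve and the first piece have different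
    germs, so their two-sided velocities may differ; a finite set does not affect the
    integral.\<close>
  also have "integral {0..1} (speed M \<gamma>) = curve_length M \<gamma>\<^sub>1"
    unfolding curve_length_eq
  proof (rule integral_spike[of "{0, 1}"])
    fix t :: real assume "t \<in> {0..1} - {0, 1}"
    then show "speed M \<gamma>\<^sub>1 t = speed M \<gamma> t"
      by (intro speed_cong[of "{0<..<1}"]) (auto simp: \<gamma>_def)
  qed simp
  also have "integral {1..2} (speed M \<gamma>) = integral {1..2} (speed M (\<lambda>t. \<gamma>\<^sub>2 (1 * t + (-1))))"
  proof (rule integral_spike[of "{1, 2}"])
    fix t :: real assume "t \<in> {1..2} - {1, 2}"
    then show "speed M (\<lambda>t. \<gamma>\<^sub>2 (1 * t + (-1))) t = speed M \<gamma> t"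
      by (intro speed_cong[of "{1<..<2}"]) (auto simp: \<gamma>_def)
  qed simp
  also have "\<dots> = curve_length M \<gamma>\<^sub>2"
    using speed_affine[OF \<gamma>01(2) _ _ im] by (simp add: curve_length_eq)
  finally have "curve_length M \<gamma>' = curve_length M \<gamma>\<^sub>1 + curve_length M \<gamma>\<^sub>2"
    using \<gamma>'(4) by simp
  then show ?thesis
    using that[OF \<gamma>'(1)] \<gamma>'(2,3) by (simp add: \<gamma>_def)
qed

end

section \<open>The Riemannian distance is a pseudometric\<close>

context connected_riemannian
begin

text \<open>The common property of \<open>chart_inv \<kappa>\<close> and \<open>R y\<close>:
  straight segments in a chart and rays of the retraction are both images of line segments under
  such a map.\<close>

definition C1_into :: "'b::real_normed_vector set \<Rightarrow> ('b \<Rightarrow> 'a) \<Rightarrow> bool" where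
  "C1_into Y \<phi> \<longleftrightarrow> open Y \<and> continuous_on Y \<phi> \<and>
     (\<forall>\<kappa>\<in>atlas M. \<forall>u\<in>Y. \<phi> u \<in> fst \<kappa> \<longrightarrow> (snd \<kappa> \<circ> \<phi>) differentiable (at u)) \<and>
     (\<forall>\<kappa>\<in>atlas M. \<forall>v. continuous_on (Y \<inter> \<phi> -` fst \<kappa>) (\<lambda>u. frechet_derivative (snd \<kappa> \<circ> \<phi>) (at u) v))"

lemma C1_into_line_derivative:
  assumes \<phi>: "C1_into Y \<phi>" and \<kappa>: "\<kappa> \<in> atlas M" "u + t *\<^sub>R v \<in> Y" "\<phi> (u + t *\<^sub>R v) \<in> fst \<kappa>"
  shows "((snd \<kappa> \<circ> (\<lambda>t. \<phi> (u + t *\<^sub>R v))) has_vector_derivative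
    frechet_derivative (snd \<kappa> \<circ> \<phi>) (at (u + t *\<^sub>R v)) v) (at t within T)"
proof -
  let ?l = "\<lambda>t. u + t *\<^sub>R v"
  have "(?l has_vector_derivative v) (at t within T)"
    by (auto intro!: derivative_eq_intros)
  moreover have "(snd \<kappa> \<circ> \<phi>) differentiable (at (?l t))"
    using \<phi> \<kappa> unfolding C1_into_def by blast
  then have "((snd \<kappa> \<circ> \<phi>) has_derivative frechet_derivative (snd \<kappa> \<circ> \<phi>) (at (?l t))) (at (?l t) within ?l ` T)"
    unfolding frechet_derivative_works by (rule has_derivative_at_withinI)
  ultimately have "((snd \<kappa> \<circ> \<phi>) \<circ> ?l has_vector_derivative
      frechet_derivative (snd \<kappa> \<circ> \<phi>) (at (?l t)) v) (at t within T)"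
    by (rule vector_derivative_diff_chain_within)
  then show ?thesis
    by (simp add: o_def)
qed

lemma C1_into_line:
  assumes \<phi>: "C1_into Y \<phi>" and sub: "\<And>t. t \<in> {a..b} \<Longrightarrow> u + t *\<^sub>R v \<in> Y"
  shows "pw_C1_on M a b (\<lambda>t. \<phi> (u + t *\<^sub>R v))"
proof (rule pw_C1_onI[of _ _ _ "{}"])
  let ?l = "\<lambda>t. u + t *\<^sub>R v"
  have l: "continuous_on T ?l" for T
    by (intro continuous_intros)
  have "continuous_on Y \<phi>"
    using \<phi> by (simp add: C1_into_def)
  then show "continuous_on {a..b} (\<lambda>t. \<phi> (?l t))"
    by (rule continuous_on_compose2[OF _ l]) (use sub in blast)
  fix \<kappa> a' b' assume \<kappa>: "\<kappa> \<in> atlas M" and ab: "a \<le> a'" "a' < b'" "b' \<le> b"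
    and im: "(\<lambda>t. \<phi> (?l t)) ` {a'..b'} \<subseteq> fst \<kappa>"
  have sub': "?l t \<in> Y" "\<phi> (?l t) \<in> fst \<kappa>" if "t \<in> {a'..b'}" for t
    using that ab im sub by auto
  show "C1_in_chart \<kappa> (\<lambda>t. \<phi> (?l t)) a' b'"
    unfolding C1_in_chart_def
  proof (intro exI conjI ballI)
    have "continuous_on (Y \<inter> \<phi> -` fst \<kappa>) (\<lambda>u. frechet_derivative (snd \<kappa> \<circ> \<phi>) (at u) v)"
      using \<phi> \<kappa> by (simp add: C1_into_def)
    then show "continuous_on {a'..b'} (\<lambda>t. frechet_derivative (snd \<kappa> \<circ> \<phi>) (at (?l t)) v)"
      by (rule continuous_on_compose2[OF _ l]) (use sub' in blast)
  qed (intro C1_into_line_derivative[OF \<phi> \<kappa>] sub')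
qed simp

lemma velocity_line:
  assumes \<phi>: "C1_into Y \<phi>" and "u + t *\<^sub>R v \<in> Y"
  shows "velocity M (\<lambda>t. \<phi> (u + t *\<^sub>R v)) t =
    frechet_derivative (snd (chart_at M (\<phi> (u + t *\<^sub>R v))) \<circ> \<phi>) (at (u + t *\<^sub>R v)) v"
  unfolding velocity_def
  by (rule vector_derivative_at[OF C1_into_line_derivative[OF \<phi> chart_at(1) assms(2) chart_at(2)]])

lemma chart_inv_C1_into:
  assumes \<kappa>: "\<kappa> \<in> atlas M"
  shows "C1_into (chart_image \<kappa>) (chart_inv \<kappa>)"
proof -
  have "chart_image \<kappa> \<inter> chart_inv \<kappa> -` fst \<kappa>' = {p \<in> chart_image \<kappa>. chart_inv \<kappa> p \<in> fst \<kappa>'}" for \<kappa>'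
    by auto
  then show ?thesis
    unfolding C1_into_def using chart_open(2)[OF \<kappa>] chart_continuous(2)[OF \<kappa>]
      smooth_onD(2,3)[OF transition_smooth[OF \<kappa>]] by auto
qed

lemma constant_curve:
  obtains \<gamma> where "pw_C1_curve M \<gamma>" "\<gamma> 0 = y" "\<gamma> 1 = y" "curve_length M \<gamma> = 0"
proof -
  let ?\<kappa> = "chart_at M y"
  \<comment> \<open>The summand with direction 0 presents the constant curve as a line in a
    chart.\<close>
  let ?\<gamma> = "\<lambda>t. chart_inv ?\<kappa> (snd ?\<kappa> y + t *\<^sub>R 0)"
  note C1 = chart_inv_C1_into[OF chart_at(1)]
  have y: "snd ?\<kappa> y \<in> chart_image ?\<kappa>" "chart_inv ?\<kappa> (snd ?\<kappa> y) = y"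
    using chart_inverse(1,2)[OF chart_at(1)] chart_at(2) by auto
  have "velocity M ?\<gamma> t = 0" for t
    unfolding velocity_def by (rule vector_derivative_at) (auto simp: o_def)
  then have "speed M ?\<gamma> = (\<lambda>t. 0)"
    by (auto simp: speed_def)
  then show ?thesis
    using that[of ?\<gamma>] C1_into_line[OF C1[of y], of 0 1 "snd ?\<kappa> y" 0] y
    by (simp add: pw_C1_curve_iff curve_length_eq)
qed

text \<open>Being joined by a curve is an equivalence relation, by reversal and concatenation, and
  straight segments in a chart ball make its classes open. On a connected space there is then only
  one class.\<close>

lemma curve_exists:
  "\<exists>\<gamma>. pw_C1_curve M \<gamma> \<and> \<gamma> 0 = y \<and> \<gamma> 1 = z"
proof (rule connected_equivalence_relation[OF connected, where R = "\<lambda>y z. \<exists>\<gamma>. pw_C1_curve M \<gamma> \<and> \<gamma> 0 = y \<and> \<gamma> 1 = z"])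
  fix y z assume "\<exists>\<gamma>. pw_C1_curve M \<gamma> \<and> \<gamma> 0 = y \<and> \<gamma> 1 = z"
  then obtain \<gamma> where \<gamma>: "pw_C1_curve M \<gamma>" "\<gamma> 0 = y" "\<gamma> 1 = z"
    by blast
  obtain g where "pw_C1_curve M g" "g 0 = \<gamma> 1" "g 1 = \<gamma> 0"
    by (rule pw_C1_curve_reverse[OF \<gamma>(1)])
  then show "\<exists>\<gamma>. pw_C1_curve M \<gamma> \<and> \<gamma> 0 = z \<and> \<gamma> 1 = y"
    using \<gamma> by (intro exI[of _ g]) simp
next
  fix w y z assume "\<exists>\<gamma>. pw_C1_curve M \<gamma> \<and> \<gamma> 0 = w \<and> \<gamma> 1 = y" "\<exists>\<gamma>. pw_C1_curve M \<gamma> \<and> \<gamma> 0 = y \<and> \<gamma> 1 = z"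
  then obtain \<gamma> \<gamma>' where \<gamma>: "pw_C1_curve M \<gamma>" "\<gamma> 0 = w" "\<gamma> 1 = y" "pw_C1_curve M \<gamma>'" "\<gamma>' 0 = y" "\<gamma>' 1 = z"
    by blast
  obtain g where "pw_C1_curve M g" "g 0 = \<gamma> 0" "g 1 = \<gamma>' 1"
    by (rule pw_C1_curve_join[OF \<gamma>(1,4)]) (simp_all add: \<gamma>)
  then show "\<exists>\<gamma>. pw_C1_curve M \<gamma> \<and> \<gamma> 0 = w \<and> \<gamma> 1 = z"
    using \<gamma> by (intro exI[of _ g]) simp
next
  fix y
  let ?\<kappa> = "chart_at M y"
  have y: "snd ?\<kappa> y \<in> chart_image ?\<kappa>" "chart_inv ?\<kappa> (snd ?\<kappa> y) = y"
    using chart_inverse(1,2)[OF chart_at(1)] chart_at(2) by auto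
  obtain e where e: "e > 0" "ball (snd ?\<kappa> y) e \<subseteq> chart_image ?\<kappa>"
    using chart_open(2)[OF chart_at(1)] y(1) by (meson open_contains_ball)
  define T where "T = fst ?\<kappa> \<inter> snd ?\<kappa> -` ball (snd ?\<kappa> y) e"
  have "open T"
    unfolding T_def
    by (intro continuous_open_preimage chart_continuous(1) chart_open(1) chart_at(1) open_ball)
  moreover have "\<exists>\<gamma>. pw_C1_curve M \<gamma> \<and> \<gamma> 0 = y \<and> \<gamma> 1 = z" if z: "z \<in> T" for z
  proof -
    let ?v = "snd ?\<kappa> z - snd ?\<kappa> y"
    have "snd ?\<kappa> y + t *\<^sub>R ?v \<in> chart_image ?\<kappa>" if t: "t \<in> {0..1}" for t
    proof -
      have "norm (t *\<^sub>R ?v) \<le> 1 * norm ?v"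
        unfolding norm_scaleR using t by (intro mult_right_mono) auto
      also have "\<dots> < e"
        using z by (simp add: T_def dist_norm norm_minus_commute)
      finally show ?thesis
        using e(2) by (intro subsetD[OF e(2)]) (simp add: dist_norm)
    qed
    then have "pw_C1_on M 0 1 (\<lambda>t. chart_inv ?\<kappa> (snd ?\<kappa> y + t *\<^sub>R ?v))"
      by (rule C1_into_line[OF chart_inv_C1_into[OF chart_at(1)]])
    then show ?thesis
      using y z by (intro exI[of _ "\<lambda>t. chart_inv ?\<kappa> (snd ?\<kappa> y + t *\<^sub>R ?v)"])
        (simp add: pw_C1_curve_iff chart_inverse(2)[OF chart_at(1)] T_def)
  qed
  moreover have "y \<in> T"
    using e(1) chart_at by (simp add: T_def)
  ultimately show "\<exists>T. openin (top_of_set UNIV) T \<and> y \<in> T \<and>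
      (\<forall>z\<in>T. \<exists>\<gamma>. pw_C1_curve M \<gamma> \<and> \<gamma> 0 = y \<and> \<gamma> 1 = z)"
    by auto
qed auto

text \<open>The infimum in \<open>rdist\<close> is taken in the reals, so lower bounds for it
  presuppose that there is a curve at all.\<close>

lemma curves_nonempty: "{\<gamma>. pw_C1_curve M \<gamma> \<and> \<gamma> 0 = y \<and> \<gamma> 1 = z} \<noteq> {}"
  using curve_exists[of y z] by blast

lemma rdist_nonneg: "rdist M y z \<ge> 0"
  unfolding rdist_def by (intro cINF_greatest curves_nonempty curve_length_nonneg)

lemma rdist_curveE:
  assumes "rdist M y z < D"
  obtains \<gamma> where "pw_C1_curve M \<gamma>" "\<gamma> 0 = y" "\<gamma> 1 = z" "curve_length M \<gamma> < D"
proof -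
  have "bdd_below (curve_length M ` {\<gamma>. pw_C1_curve M \<gamma> \<and> \<gamma> 0 = y \<and> \<gamma> 1 = z})"
    by (intro bdd_belowI2[of _ 0] curve_length_nonneg)
  from cINF_less_iff[OF curves_nonempty this] assms
  have "\<exists>\<gamma>\<in>{\<gamma>. pw_C1_curve M \<gamma> \<and> \<gamma> 0 = y \<and> \<gamma> 1 = z}. curve_length M \<gamma> < D"
    by (simp add: rdist_def)
  then show ?thesis
    using that by blast
qed

lemma rdist_self [simp]: "rdist M y y = 0"
  using constant_curve[of y] rdist_le_curve_length rdist_nonneg by (metis order_antisym)

lemma rdist_sym: "rdist M y z = rdist M z y"
proof -
  have "rdist M y z \<le> rdist M z y" for y z
  proof (rule ccontr)
    assume "\<not> rdist M y z \<le> rdist M z y"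
    then obtain \<gamma> where \<gamma>: "pw_C1_curve M \<gamma>" "\<gamma> 0 = z" "\<gamma> 1 = y" "curve_length M \<gamma> < rdist M y z"
      using rdist_curveE by (metis not_le)
    obtain \<gamma>' where "pw_C1_curve M \<gamma>'" "\<gamma>' 0 = \<gamma> 1" "\<gamma>' 1 = \<gamma> 0" "curve_length M \<gamma>' = curve_length M \<gamma>"
      using pw_C1_curve_reverse[OF \<gamma>(1)] by blast
    then show False
      using rdist_le_curve_length[of \<gamma>' y z] \<gamma> by simp
  qed
  then show ?thesis
    by (intro order_antisym)
qed

lemma rdist_triangle: "rdist M w z \<le> rdist M w y + rdist M y z"
proof (rule field_le_epsilon)
  fix e :: real assume e: "e > 0"
  obtain \<gamma> where \<gamma>: "pw_C1_curve M \<gamma>" "\<gamma> 0 = w" "\<gamma> 1 = y" "curve_length M \<gamma> < rdist M w y + e/2"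
    using rdist_curveE[of w y "rdist M w y + e/2"] e by auto
  obtain \<gamma>' where \<gamma>': "pw_C1_curve M \<gamma>'" "\<gamma>' 0 = y" "\<gamma>' 1 = z" "curve_length M \<gamma>' < rdist M y z + e/2"
    using rdist_curveE[of y z "rdist M y z + e/2"] e by auto
  obtain g where "pw_C1_curve M g" "g 0 = \<gamma> 0" "g 1 = \<gamma>' 1" "curve_length M g = curve_length M \<gamma> + curve_length M \<gamma>'"
    using pw_C1_curve_join[OF \<gamma>(1) \<gamma>'(1)] \<gamma>(3) \<gamma>'(2) by auto
  then show "rdist M w z \<le> rdist M w y + rdist M y z + e"
    using rdist_le_curve_length[of g w z] \<gamma> \<gamma>' by simp
qed

lemma rdist_le_integral:
  assumes \<gamma>: "pw_C1_on M l u \<gamma>" and "l \<le> u"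
  shows "rdist M (\<gamma> l) (\<gamma> u) \<le> integral {l..u} (speed M \<gamma>)"
proof (cases "l = u")
  case False
  then obtain \<gamma>' where "pw_C1_curve M \<gamma>'" "\<gamma>' 0 = \<gamma> l" "\<gamma>' 1 = \<gamma> u"
    "curve_length M \<gamma>' = integral {l..u} (speed M \<gamma>)"
    using pw_C1_on_reparametrize[OF \<gamma>] assms(2) by auto
  then show ?thesis
    using rdist_le_curve_length by metis
qed simp

end

section \<open>Comparing the distance with the retraction\<close>

context connected_riemannian
begin

text \<open>In the bundle coordinates of the distinguished chart at \<open>y\<close>, where
  \<open>tvec\<close> is the identity, \<open>R y\<close> is the restriction of the jointly smooth
  map \<open>h\<close> to the slice with first component \<open>?p\<close>.\<close>

lemma retraction_C1_into:
  assumes retr: "retraction_on M R"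
  shows "C1_into UNIV (R y)"
proof -
  let ?\<kappa> = "chart_at M y" and ?p = "snd (chart_at M y) y"
  define h where "h = (\<lambda>(p, v). R (chart_inv ?\<kappa> p) (tvec M ?\<kappa> (chart_inv ?\<kappa> p) v))"
  define W where "W \<kappa> = {(p, v). p \<in> chart_image ?\<kappa> \<and> h (p, v) \<in> fst \<kappa>}" for \<kappa> :: "('a, 'n) chart"
  have p: "?p \<in> chart_image ?\<kappa>" "chart_inv ?\<kappa> ?p = y"
    using chart_inverse(1,2)[OF chart_at(1)] chart_at(2) by auto
  have W: "open (W \<kappa>)" "smooth_on (W \<kappa>) (snd \<kappa> \<circ> h)" if "\<kappa> \<in> atlas M" for \<kappa>
    using retr chart_at(1)[of y] that unfolding retraction_on_def W_def h_def Let_def by blast+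
  have h: "h (?p, v) = R y v" for v
    by (simp add: h_def p(2) tvec_chart_at)
  then have hR: "snd \<kappa> \<circ> R y = (snd \<kappa> \<circ> h) \<circ> (\<lambda>v. (?p, v))" for \<kappa> :: "('a, 'n) chart"
    by (simp add: fun_eq_iff)
  have mem: "(?p, u) \<in> W \<kappa> \<longleftrightarrow> R y u \<in> fst \<kappa>" for u \<kappa>
    by (simp add: W_def h p(1))
  have D: "((snd \<kappa> \<circ> R y) has_derivative (\<lambda>v. frechet_derivative (snd \<kappa> \<circ> h) (at (?p, u)) (0, v))) (at u)"
    if \<kappa>: "\<kappa> \<in> atlas M" "R y u \<in> fst \<kappa>" for \<kappa> u
  proof -
    have "((snd \<kappa> \<circ> h) has_derivative frechet_derivative (snd \<kappa> \<circ> h) (at (?p, u))) (at (?p, u))"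
      using smooth_on_has_derivative[OF W(2)[OF \<kappa>(1)]] mem \<kappa>(2) by blast
    moreover have "((\<lambda>v. (?p, v)) has_derivative (\<lambda>v. (0, v))) (at u)"
      by (auto intro!: derivative_eq_intros)
    ultimately show ?thesis
      unfolding hR by (drule_tac diff_chain_at) (simp_all add: o_def)
  qed
  have "isCont (R y) u" for u
  proof -
    let ?\<kappa>' = "chart_at M (R y u)"
    \<comment> \<open>Differentiability in a chart says nothing about leaving that chart. The slice
      of the open set \<open>W\<close> guarantees that \<open>R y\<close> stays in the chart domain
      near \<open>u\<close>.\<close>
    have "open {v. (?p, v) \<in> W ?\<kappa>'}"
      using open_vimage[OF W(1)[OF chart_at(1)], of "\<lambda>v. (?p, v)"]
      by (simp add: vimage_def continuous_intros)
    then have o: "open {v. R y v \<in> fst ?\<kappa>'}"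
      by (simp add: mem)
    have "isCont (snd ?\<kappa>' \<circ> R y) u"
      using D[OF chart_at] by (rule has_derivative_continuous)
    moreover have "isCont (chart_inv ?\<kappa>') ((snd ?\<kappa>' \<circ> R y) u)"
      using isCont_chart_inv[OF chart_at(1)] chart_inverse(1)[OF chart_at(1) chart_at(2)] by simp
    ultimately have "isCont (chart_inv ?\<kappa>' \<circ> (snd ?\<kappa>' \<circ> R y)) u"
      by (rule continuous_at_compose)
    moreover have "\<forall>\<^sub>F v in nhds u. v \<in> {v. R y v \<in> fst ?\<kappa>'}"
      using o chart_at(2) by (intro eventually_nhds_in_open) simp_all
    then have "\<forall>\<^sub>F v in nhds u. (chart_inv ?\<kappa>' \<circ> (snd ?\<kappa>' \<circ> R y)) v = R y v"
      by eventually_elim (simp add: chart_inverse(2)[OF chart_at(1)])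
    ultimately show ?thesis
      using isCont_cong by blast
  qed
  then have "continuous_on UNIV (R y)"
    by (simp add: continuous_at_imp_continuous_on)
  moreover have "(snd \<kappa> \<circ> R y) differentiable (at u)" if "\<kappa> \<in> atlas M" "R y u \<in> fst \<kappa>" for \<kappa> u
    using D[OF that] unfolding differentiable_def by blast
  moreover have "continuous_on (UNIV \<inter> R y -` fst \<kappa>) (\<lambda>u. frechet_derivative (snd \<kappa> \<circ> R y) (at u) v)"
    if \<kappa>: "\<kappa> \<in> atlas M" for \<kappa> v
  proof -
    have "continuous_on (R y -` fst \<kappa>) (\<lambda>u. frechet_derivative (snd \<kappa> \<circ> h) (at (?p, u)) (0, v))"
      by (rule continuous_on_compose2[OF smooth_onD(3)[OF W(2)[OF \<kappa>]]])
        (auto intro!: continuous_intros simp: mem)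
    moreover have "frechet_derivative (snd \<kappa> \<circ> h) (at (?p, u)) (0, v) = frechet_derivative (snd \<kappa> \<circ> R y) (at u) v"
      if "u \<in> R y -` fst \<kappa>" for u
      using frechet_derivative_at[OF D[OF \<kappa>, of u]] that by (simp add: fun_eq_iff)
    ultimately have "continuous_on (R y -` fst \<kappa>) (\<lambda>u. frechet_derivative (snd \<kappa> \<circ> R y) (at u) v)"
      by (rule continuous_on_eq)
    then show ?thesis
      by simp
  qed
  ultimately show ?thesis
    unfolding C1_into_def by simp
qed

lemma diffeo_inverse_has_derivative:
  assumes "diffeo_onto_image M h V" "y \<in> h ` V" "\<kappa> \<in> atlas M" "y \<in> fst \<kappa>"
  shows "((inv_into V h \<circ> chart_inv \<kappa>) has_derivative
    frechet_derivative (inv_into V h \<circ> chart_inv \<kappa>) (at (snd \<kappa> y))) (at (snd \<kappa> y))"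
proof (rule smooth_on_has_derivative)
  show "smooth_on (snd \<kappa> ` (h ` V \<inter> fst \<kappa>)) (inv_into V h \<circ> chart_inv \<kappa>)"
    using assms(1,3) unfolding diffeo_onto_image_def by blast
qed (use assms in blast)

lemma diffeo_inverse_continuous:
  assumes h: "diffeo_onto_image M h V"
  shows "continuous_on (h ` V) (inv_into V h)"
proof (intro continuous_at_imp_continuous_on ballI)
  fix y assume y: "y \<in> h ` V"
  let ?\<kappa> = "chart_at M y"
  have "isCont (inv_into V h \<circ> chart_inv ?\<kappa>) (snd ?\<kappa> y)"
    using diffeo_inverse_has_derivative[OF h y chart_at] by (rule has_derivative_continuous)
  then have "isCont ((inv_into V h \<circ> chart_inv ?\<kappa>) \<circ> snd ?\<kappa>) y"
    by (rule continuous_at_compose[OF isCont_chart[OF chart_at]])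
  moreover have "\<forall>\<^sub>F z in nhds y. z \<in> fst ?\<kappa>"
    by (intro eventually_nhds_in_open chart_open chart_at)
  then have "\<forall>\<^sub>F z in nhds y. ((inv_into V h \<circ> chart_inv ?\<kappa>) \<circ> snd ?\<kappa>) z = inv_into V h z"
    by eventually_elim (simp add: chart_inverse(2)[OF chart_at(1)])
  ultimately show "isCont (inv_into V h) y"
    using isCont_cong by blast
qed

end

section \<open>Rays of the retraction and lifts of curves\<close>

locale retraction_ball = connected_riemannian M
  for M :: "('a::{t2_space,second_countable_topology}, 'n::finite) riem" +
  fixes R :: "'a \<Rightarrow> real^'n \<Rightarrow> 'a" and U :: "'a \<Rightarrow> (real^'n) set" and xs :: 'a and b :: real
  assumes retr: "retraction_on M R"
    and U: "\<And>y. y \<in> rcball M xs b \<Longrightarrow> 0 \<in> U y \<and> diffeo_onto_image M (R y) (U y)"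
    and U_ball: "\<And>y. y \<in> rcball M xs b \<Longrightarrow> rcball M xs b \<subseteq> R y ` U y"
begin

lemma retraction_0 [simp]: "R y 0 = y"
  using retr by (simp add: retraction_on_def)

lemma inj_on_U: "y \<in> rcball M xs b \<Longrightarrow> inj_on (R y) (U y)"
  and open_U: "y \<in> rcball M xs b \<Longrightarrow> open (U y)"
  using U unfolding diffeo_onto_image_def by blast+

lemma Rinv_R: "y \<in> rcball M xs b \<Longrightarrow> u \<in> U y \<Longrightarrow> Rinv R U y (R y u) = u"
  unfolding Rinv_def by (intro inv_into_f_f inj_on_U)

lemma Rinv_self: "y \<in> rcball M xs b \<Longrightarrow> Rinv R U y y = 0"
  using Rinv_R[of y 0] U by simp

lemma Rinv_in: "z \<in> R y ` U y \<Longrightarrow> Rinv R U y z \<in> U y"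
  and R_Rinv: "z \<in> R y ` U y \<Longrightarrow> R y (Rinv R U y z) = z"
  unfolding Rinv_def by (auto intro: inv_into_into f_inv_into_f)

lemma Rinv_continuous: "y \<in> rcball M xs b \<Longrightarrow> continuous_on (R y ` U y) (Rinv R U y)"
  using diffeo_inverse_continuous U unfolding Rinv_def[abs_def] by blast

lemma R_chart_has_derivative:
  assumes "\<kappa> \<in> atlas M" "R y u \<in> fst \<kappa>"
  shows "((snd \<kappa> \<circ> R y) has_derivative frechet_derivative (snd \<kappa> \<circ> R y) (at u)) (at u)"
  using retraction_C1_into[OF retr, of y] assms
  unfolding C1_into_def frechet_derivative_works by blast

lemma R_continuous: "continuous_on UNIV (R y)"
  using retraction_C1_into[OF retr, of y] by (simp add: C1_into_def)

lemma dR_eq: "dR M R y u = frechet_derivative (snd (chart_at M (R y u)) \<circ> R y) (at u)"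
  by (simp add: fun_eq_iff dR_def)

lemma dR_linear: "linear (dR M R y u)"
  unfolding dR_eq by (rule has_derivative_linear[OF R_chart_has_derivative[OF chart_at]])

text \<open>Differentiating the smooth inverse composed with \<open>R y\<close> in the chart at
  \<open>R y u\<close> yields a left inverse of \<open>dR\<close>. This is the source of the
  positivity of \<open>lmin\<close>.\<close>

lemma dR_injective:
  assumes y: "y \<in> rcball M xs b" "u \<in> U y" and 0: "dR M R y u v = 0"
  shows "v = 0"
proof -
  let ?\<kappa> = "chart_at M (R y u)"
  let ?g = "inv_into (U y) (R y)"
  let ?D = "frechet_derivative (?g \<circ> chart_inv ?\<kappa>) (at (snd ?\<kappa> (R y u)))"
  have dg: "((?g \<circ> chart_inv ?\<kappa>) has_derivative ?D) (at ((snd ?\<kappa> \<circ> R y) u))"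
    using diffeo_inverse_has_derivative[of "R y" "U y" "R y u" ?\<kappa>] U[OF y(1)] y(2) chart_at by auto
  have "((?g \<circ> chart_inv ?\<kappa>) \<circ> (snd ?\<kappa> \<circ> R y) has_derivative ?D \<circ> dR M R y u) (at u)"
    unfolding dR_eq by (rule diff_chain_at[OF R_chart_has_derivative[OF chart_at] dg])
  moreover have "open (U y \<inter> R y -` fst ?\<kappa>)"
    using U[OF y(1)] chart_at(1)[of "R y u"] unfolding diffeo_onto_image_def by blast
  moreover have "u \<in> U y \<inter> R y -` fst ?\<kappa>"
    using y(2) chart_at(2) by simp
  moreover have "((?g \<circ> chart_inv ?\<kappa>) \<circ> (snd ?\<kappa> \<circ> R y)) w = w" if "w \<in> U y \<inter> R y -` fst ?\<kappa>" for w
    using that inv_into_f_f[OF inj_on_U[OF y(1)]] chart_inverse(2)[OF chart_at(1)] by simp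
  ultimately have "((\<lambda>w. w) has_derivative ?D \<circ> dR M R y u) (at u)"
    by (rule has_derivative_transform_within_open)
  then have "(?D \<circ> dR M R y u) v = v"
    using has_derivative_unique[OF has_derivative_ident] by (metis (no_types))
  then show ?thesis
    using 0 linear_0[OF has_derivative_linear[OF dg]] by simp
qed

text \<open>
  \<open>U y\<close> need not be star-shaped. But \<open>Rinv (R y (t v))\<close> is a continuous lift of the ray, and the
  times where it equals \<open>t v\<close> are both closed and open.
\<close>

lemma ray_in_U:
  assumes y: "y \<in> rcball M xs b" and "0 < \<tau>"
    and ball: "\<And>t. 0 \<le> t \<Longrightarrow> t < \<tau> \<Longrightarrow> R y (t *\<^sub>R v) \<in> rcball M xs b"
    and t: "0 \<le> t" "t < \<tau>"
  shows "t *\<^sub>R v \<in> U y"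
proof -
  let ?I = "{0..<\<tau>}"
  have im: "R y (t *\<^sub>R v) \<in> R y ` U y" if "t \<in> ?I" for t
    using ball U_ball[OF y] that by auto
  have eq: "{t \<in> ?I. Rinv R U y (R y (t *\<^sub>R v)) - t *\<^sub>R v = 0} = ?I \<inter> (\<lambda>t. t *\<^sub>R v) -` U y"
    using Rinv_R[OF y] Rinv_in[OF im] by fastforce
  have "continuous_on ?I (\<lambda>t. R y (t *\<^sub>R v))"
    by (rule continuous_on_compose2[OF R_continuous]) (simp_all add: continuous_intros)
  then have "continuous_on ?I (\<lambda>t. Rinv R U y (R y (t *\<^sub>R v)))"
    by (rule continuous_on_compose2[OF Rinv_continuous[OF y]]) (use im in blast)
  then have "continuous_on ?I (\<lambda>t. Rinv R U y (R y (t *\<^sub>R v)) - t *\<^sub>R v)"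
    by (intro continuous_intros)
  then have "closedin (top_of_set ?I) {t \<in> ?I. Rinv R U y (R y (t *\<^sub>R v)) - t *\<^sub>R v = 0}"
    by (rule continuous_closedin_preimage_constant)
  moreover have "openin (top_of_set ?I) (?I \<inter> (\<lambda>t. t *\<^sub>R v) -` U y)"
    by (intro continuous_openin_preimage_gen open_U[OF y] continuous_intros)
  moreover have "connected ?I"
    by simp
  moreover have "0 \<in> ?I \<inter> (\<lambda>t. t *\<^sub>R v) -` U y"
    using U[OF y] assms(2) by simp
  ultimately have "?I \<subseteq> (\<lambda>t. t *\<^sub>R v) -` U y"
    unfolding eq connected_clopen by blast
  moreover have "t \<in> ?I"
    using t by simp
  ultimately show ?thesis
    by blast
qed

lemma speed_ray: "speed M (\<lambda>t. R y (t *\<^sub>R v)) t = tnorm M (R y (t *\<^sub>R v)) (dR M R y (t *\<^sub>R v) v)"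
  using velocity_line[OF retraction_C1_into[OF retr, of y], of 0 t v]
  by (simp add: speed_def dR_def)

lemma rcball_I: "rdist M xs y \<le> b \<Longrightarrow> y \<in> rcball M xs b"
  by (simp add: rcball_def)

text \<open>A continuity argument along the ray breaks the circle between the speed bound and
  staying in the ball. The conclusion \<open>v \<in> U y\<close> matters as much as the distance
  bound: it identifies \<open>v\<close> with \<open>Rinv R U y (R y v)\<close>.\<close>

lemma ray_stays:
  assumes y: "y \<in> rcball M xs b" and "k \<ge> 0"
    and k: "\<And>u. u \<in> U y \<Longrightarrow> R y u \<in> rcball M xs b \<Longrightarrow> tnorm M (R y u) (dR M R y u v) \<le> k * tnorm M y v"
    and small: "rdist M xs y + k * tnorm M y v < b"
  shows "v \<in> U y" and "R y v \<in> rcball M xs b" and "rdist M y (R y v) \<le> k * tnorm M y v"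
proof -
  let ?\<gamma> = "\<lambda>t. R y (t *\<^sub>R v)"
  define J where "J t = integral {0..t} (speed M ?\<gamma>)" for t
  have C1: "pw_C1_on M 0 t ?\<gamma>" for t
    using C1_into_line[OF retraction_C1_into[OF retr, of y], of 0 t 0 v] by simp
  have dist: "rdist M y (?\<gamma> t) \<le> J t" if "0 \<le> t" for t
    using rdist_le_integral[OF C1 that] by (simp add: J_def)
  then have dist_xs: "rdist M xs (?\<gamma> t) \<le> rdist M xs y + J t" if "0 \<le> t" for t
    using rdist_triangle[of xs "?\<gamma> t" y] that by fastforce
  \<comment> \<open>Half-open intervals, because the ray need not be under control at
    \<open>\<tau>\<close> itself. The speed is therefore compared with a constant altered at this
    one point.\<close>
  have J_le: "J \<tau> \<le> k * tnorm M y v * \<tau> \<and> (\<forall>t\<in>{0..<\<tau>}. t *\<^sub>R v \<in> U y)"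
    if \<tau>: "0 < \<tau>" and J: "\<And>t. t \<in> {0..<\<tau>} \<Longrightarrow> J t \<le> b - rdist M xs y" for \<tau>
  proof -
    have ball: "?\<gamma> t \<in> rcball M xs b" if "0 \<le> t" "t < \<tau>" for t
      using dist_xs[of t] J[of t] that by (intro rcball_I) auto
    then have inU: "t *\<^sub>R v \<in> U y" if "0 \<le> t" "t < \<tau>" for t
      using ray_in_U[OF y \<tau>, of v t] that by blast
    have "speed M ?\<gamma> t \<le> k * tnorm M y v" if "0 \<le> t" "t < \<tau>" for t
      unfolding speed_ray using k inU ball that by blast
    then have "(J \<tau>) \<le> integral {0..\<tau>} (\<lambda>t. if t = \<tau> then speed M ?\<gamma> \<tau> else k * tnorm M y v)"
      unfolding J_def
      by (intro integral_le speed_integrable C1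
          integrable_spike_finite[OF finite.insertI[OF finite.emptyI, of \<tau>] _ integrable_const_ivl[of "k * tnorm M y v"]])
         auto
    also have "\<dots> = integral {0..\<tau>} (\<lambda>t. k * tnorm M y v)"
      by (rule integral_spike[of "{\<tau>}"]) auto
    also have "\<dots> = k * tnorm M y v * \<tau>"
      using \<tau> by simp
    finally show ?thesis
      using inU by auto
  qed
  have kv: "k * tnorm M y v * t \<le> k * tnorm M y v" if "t \<le> 1" for t
    using mult_left_mono[OF that, of "k * tnorm M y v"] assms(2) by simp
  \<comment> \<open>Going up to 2 makes 1 an interior point, so that \<open>J\<close> is continuous
    there from both sides.\<close>
  have cont: "continuous_on {0..2} J"
    unfolding J_def by (rule indefinite_integral_continuous_1[OF speed_integrable[OF C1]])
  define C where "C = {0..2} \<inter> J -` {b - rdist M xs y..}"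
  \<comment> \<open>Before the first time \<open>\<tau>\<close> at which the length \<open>J\<close> reaches \<open>b - rdist M xs y\<close> the ray stays in the
    ball, where its speed is at most \<open>k * tnorm M y v\<close>; so \<open>J \<tau>\<close> is too small.\<close>
  have J_small: "J t < b - rdist M xs y" if t: "0 \<le> t" "t \<le> 1" for t
  proof (rule ccontr)
    assume "\<not> J t < b - rdist M xs y"
    then have "C \<noteq> {}"
      using t by (intro ex_in_conv[THEN iffD1] exI[of _ t]) (simp add: C_def)
    moreover have "compact C"
      unfolding C_def compact_eq_bounded_closed
      by (intro conjI continuous_closed_preimage[OF cont] bounded_Int) auto
    ultimately obtain \<tau> where \<tau>: "\<tau> \<in> C" "\<And>s. s \<in> C \<Longrightarrow> \<tau> \<le> s"
      using compact_attains_inf[of C] by auto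
    have "\<tau> \<le> 1"
      using \<tau>(2)[of t] t \<open>\<not> J t < b - rdist M xs y\<close> by (auto simp: C_def)
    have "J 0 = 0"
      by (simp add: J_def)
    then have "J 0 < b - rdist M xs y"
      using small mult_nonneg_nonneg[OF assms(2) tnorm_nonneg, of y v] by linarith
    then have "0 < \<tau>"
      using \<tau>(1) by (cases "\<tau> = 0") (auto simp: C_def)
    moreover have "J s \<le> b - rdist M xs y" if "s \<in> {0..<\<tau>}" for s
      using \<tau>(2)[of s] that \<open>\<tau> \<le> 1\<close> by (force simp: C_def)
    ultimately have "J \<tau> \<le> k * tnorm M y v * \<tau>"
      using J_le by blast
    then show False
      using kv[OF \<open>\<tau> \<le> 1\<close>] \<tau>(1) small by (auto simp: C_def)
  qed
  have fin: "J 1 \<le> k * tnorm M y v"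
    using J_le[of 1] J_small kv[of 1] by force
  show "R y v \<in> rcball M xs b"
    using dist_xs[of 1] J_small[of 1] by (intro rcball_I) auto
  show "rdist M y (R y v) \<le> k * tnorm M y v"
    using dist[of 1] fin by simp
  \<comment> \<open>\<open>J_le\<close> reaches only times before \<open>\<tau>\<close>. The strict
    inequality at 1 persists a little beyond 1, which brings \<open>t = 1\<close>, that is
    \<open>v\<close> itself, into its range.\<close>
  have "\<exists>\<tau>>1. \<forall>t\<in>{0..\<tau>}. J t \<le> b - rdist M xs y"
  proof -
    have "(J \<longlongrightarrow> J 1) (at 1)"
      using continuous_on_interior[OF cont, of 1] by (simp add: isCont_def)
    then have "\<forall>\<^sub>F t in at 1. J t < b - rdist M xs y"
      using J_small[of 1] by (intro order_tendstoD(2)) auto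
    then obtain d where d: "d > 0" "\<And>t. t \<noteq> 1 \<Longrightarrow> dist t 1 < d \<Longrightarrow> J t < b - rdist M xs y"
      unfolding eventually_at by auto
    have "J t \<le> b - rdist M xs y" if "t \<in> {0..1 + d/2}" for t
      using J_small[of t] d(2)[of t] that d(1) by (cases "t \<le> 1") (auto simp: dist_real_def)
    then show ?thesis
      using d(1) by (intro exI[of _ "1 + d/2"]) auto
  qed
  then obtain \<tau> where "\<tau> > 1" "\<forall>t\<in>{0..\<tau>}. J t \<le> b - rdist M xs y"
    by blast
  then have "\<forall>t\<in>{0..<\<tau>}. t *\<^sub>R v \<in> U y"
    using J_le[of \<tau>] by auto
  then show "v \<in> U y"
    using \<open>\<tau> > 1\<close> by (auto dest: bspec[of _ _ 1])
qed

text \<open>The lift of the curve by the inverse of \<open>R (\<gamma> 0)\<close> runs from 0 to the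
  vector to be bounded, and \<open>dR\<close> carries its velocity to that of
  \<open>\<gamma>\<close>.\<close>

lemma Rinv_le_curve_length:
  assumes \<gamma>: "pw_C1_curve M \<gamma>" and ball: "\<And>t. t \<in> {0..1} \<Longrightarrow> \<gamma> t \<in> rcball M xs b" and "k \<ge> 0"
    and k: "\<And>u v. u \<in> U (\<gamma> 0) \<Longrightarrow> R (\<gamma> 0) u \<in> rcball M xs b \<Longrightarrow>
      tnorm M (\<gamma> 0) v \<le> k * tnorm M (R (\<gamma> 0) u) (dR M R (\<gamma> 0) u v)"
  shows "tnorm M (\<gamma> 0) (Rinv R U (\<gamma> 0) (\<gamma> 1)) \<le> k * curve_length M \<gamma>"
proof -
  define y where "y = \<gamma> 0"
  define a where "a = Rinv R U y (\<gamma> 1)"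
  define w where "w t = Rinv R U y (\<gamma> t)" for t
  have y: "y \<in> rcball M xs b"
    using ball by (simp add: y_def)
  have im: "\<gamma> t \<in> R y ` U y" if "t \<in> {0..1}" for t
    using ball U_ball[OF y] that by blast
  have C1: "pw_C1_on M 0 1 \<gamma>"
    using \<gamma> by (simp add: pw_C1_curve_iff)
  obtain S where S: "finite S"
    "\<And>t \<kappa>. t \<in> {0<..<1} - S \<Longrightarrow> \<kappa> \<in> atlas M \<Longrightarrow> \<gamma> t \<in> fst \<kappa> \<Longrightarrow>
      \<exists>d. ((snd \<kappa> \<circ> \<gamma>) has_vector_derivative d) (at t)"
    using pw_C1_on_differentiable[OF C1] by blast
  \<comment> \<open>The value 0 at the exceptional times makes the bound on the integrand hold at
    every \<open>t\<close>.\<close>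
  define w' where "w' t = (if t \<in> {0<..<1} - S then vector_derivative w (at t) else 0)" for t
  have w': "(w has_vector_derivative w' t) (at t) \<and> tnorm M y (w' t) \<le> k * speed M \<gamma> t"
    if t: "t \<in> {0<..<1} - S" for t
  proof -
    let ?\<kappa> = "chart_at M (\<gamma> t)"
    let ?g = "inv_into (U y) (R y)"
    have c: "isCont \<gamma> t"
      using pw_C1_on_isCont[OF C1] t by auto
    have t01: "t \<in> {0..1}"
      using t by auto
    obtain d where d: "((snd ?\<kappa> \<circ> \<gamma>) has_vector_derivative d) (at t)"
      using S(2)[OF t chart_at] by blast
    let ?D = "frechet_derivative (?g \<circ> chart_inv ?\<kappa>) (at (snd ?\<kappa> (\<gamma> t)))"
    have "((?g \<circ> chart_inv ?\<kappa>) has_derivative ?D) (at ((snd ?\<kappa> \<circ> \<gamma>) t) within (snd ?\<kappa> \<circ> \<gamma>) ` UNIV)"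
      using diffeo_inverse_has_derivative[of "R y" "U y" "\<gamma> t" ?\<kappa>] U[OF y] im[OF t01] chart_at
      by (auto intro: has_derivative_at_withinI)
    from vector_derivative_diff_chain_within[OF d this]
    have "((?g \<circ> chart_inv ?\<kappa>) \<circ> (snd ?\<kappa> \<circ> \<gamma>) has_vector_derivative ?D d) (at t)" .
    moreover have "\<forall>\<^sub>F s in at t. \<gamma> s \<in> fst ?\<kappa>"
      using c chart_open(1)[OF chart_at(1)] chart_at(2) unfolding isCont_def by (rule topological_tendstoD)
    then have "\<forall>\<^sub>F s in at t. ((?g \<circ> chart_inv ?\<kappa>) \<circ> (snd ?\<kappa> \<circ> \<gamma>)) s = w s"
      by eventually_elim (simp add: w_def Rinv_def chart_inverse(2)[OF chart_at(1)])
    moreover have "((?g \<circ> chart_inv ?\<kappa>) \<circ> (snd ?\<kappa> \<circ> \<gamma>)) t = w t"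
      by (simp add: w_def Rinv_def chart_inverse(2)[OF chart_at(1) chart_at(2)])
    ultimately have "(w has_vector_derivative ?D d) (at t)"
      unfolding has_vector_derivative_def by (auto intro: has_derivative_transform_eventually)
    then have w1: "(w has_vector_derivative w' t) (at t)"
      using t by (simp add: w'_def vector_derivative_at)
    have wt: "w t \<in> U y" "R y (w t) = \<gamma> t"
      using Rinv_in[OF im[OF t01]] R_Rinv[OF im[OF t01]] by (simp_all add: w_def)
    \<comment> \<open>The chain rule in the other direction, for \<open>R y\<close> after
      \<open>w\<close>, gives the velocity of \<open>\<gamma>\<close> as the image of
      \<open>w' t\<close> under \<open>dR\<close>.\<close>
    have "((snd ?\<kappa> \<circ> R y) has_derivative dR M R y (w t)) (at (w t) within w ` UNIV)"
      using R_chart_has_derivative[of ?\<kappa> y "w t"] chart_at wt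
      by (auto intro: has_derivative_at_withinI simp: dR_eq)
    from vector_derivative_diff_chain_within[OF w1 this]
    have "((snd ?\<kappa> \<circ> R y) \<circ> w has_vector_derivative dR M R y (w t) (w' t)) (at t)" .
    then have "((snd ?\<kappa> \<circ> \<gamma>) has_vector_derivative dR M R y (w t) (w' t)) (at t)"
    proof (rule has_vector_derivative_transform_within_open[of _ _ _ "{0<..<1}"])
      fix s :: real assume "s \<in> {0<..<1}"
      then show "((snd ?\<kappa> \<circ> R y) \<circ> w) s = (snd ?\<kappa> \<circ> \<gamma>) s"
        using R_Rinv[OF im, of s] by (simp add: w_def)
    qed (use t in auto)
    then have "speed M \<gamma> t = tnorm M (R y (w t)) (dR M R y (w t) (w' t))"
      by (simp add: speed_def velocity_def vector_derivative_at wt(2))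
    then have "tnorm M y (w' t) \<le> k * speed M \<gamma> t"
      using k[of "w t" "w' t"] wt ball[OF t01] by (simp add: y_def)
    then show ?thesis
      using w1 by blast
  qed
  have cw: "continuous_on {0..1} w"
    unfolding w_def
    by (rule continuous_on_compose2[OF Rinv_continuous[OF y] pw_C1_on_continuous[OF C1]]) (use im in blast)
  have lin: "bounded_linear (\<lambda>v. metric M y v a)"
    using metric_bilinear[of y] by (simp add: bilinear_def linear_conv_bounded_linear)
  \<comment> \<open>Pairing with the end point \<open>a\<close> of the lift \<open>w\<close> reduces to a real-valued integral, since \<open>tnorm M y\<close>
    is not the norm of the type.\<close>
  have "((\<lambda>t. metric M y (w' t) a) has_integral metric M y (w 1) a - metric M y (w 0) a) {0..1}"
    by (rule fundamental_theorem_of_calculus_interior_strong[OF S(1)])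
      (use w' bounded_linear.has_vector_derivative[OF lin] in
        \<open>auto intro!: continuous_on_compose2[OF linear_continuous_on[OF lin] cw]\<close>)
  moreover have "((\<lambda>t. k * speed M \<gamma> t * tnorm M y a) has_integral k * curve_length M \<gamma> * tnorm M y a) {0..1}"
    unfolding curve_length_eq
    by (intro has_integral_mult_left has_integral_mult_right integrable_integral speed_integrable C1)
  moreover have "metric M y (w' t) a \<le> k * speed M \<gamma> t * tnorm M y a" for t
  proof (cases "t \<in> {0<..<1} - S")
    case True
    then show ?thesis
      using metric_Cauchy_Schwarz[of y "w' t" a] w'[OF True]
        mult_right_mono[of "tnorm M y (w' t)" "k * speed M \<gamma> t" "tnorm M y a"] by auto
  next
    case False
    then show ?thesis
      using bilinear_lzero[OF metric_bilinear[of y], of a] assms(3) speed_nonneg by (auto simp: w'_def)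
  qed
  ultimately have "metric M y (w 1) a - metric M y (w 0) a \<le> k * curve_length M \<gamma> * tnorm M y a"
    by (rule has_integral_le)
  moreover have "w 0 = 0"
    using Rinv_self[OF y] by (simp add: w_def y_def)
  ultimately have "(tnorm M y a)\<^sup>2 \<le> k * curve_length M \<gamma> * tnorm M y a"
    using bilinear_lzero[OF metric_bilinear[of y], of a] by (simp add: tnorm_square w_def a_def)
  then have "tnorm M y a \<le> k * curve_length M \<gamma>"
    using assms(3) curve_length_nonneg[of \<gamma>] tnorm_nonneg[of y a]
    by (cases "tnorm M y a = 0") (auto simp: power2_eq_square mult_le_cancel_right)
  then show ?thesis
    by (simp add: a_def y_def)
qed

text \<open>A shortest curve need not exist. A curve is chosen whose length is below two bounds:
  \<open>?a / k\<close>, which contradicts the estimate for lifts, and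
  \<open>b - rdist M xs y\<close>, which keeps the curve in the ball.\<close>

lemma Rinv_le_rdist:
  assumes y: "y \<in> rcball M xs b" and "k > 0"
    and k: "\<And>u v. u \<in> U y \<Longrightarrow> R y u \<in> rcball M xs b \<Longrightarrow>
      tnorm M y v \<le> k * tnorm M (R y u) (dR M R y u v)"
    and small: "rdist M xs y + rdist M y z < b"
  shows "tnorm M y (Rinv R U y z) \<le> k * rdist M y z"
proof (rule ccontr)
  let ?a = "tnorm M y (Rinv R U y z)"
  assume "\<not> ?a \<le> k * rdist M y z"
  then have "rdist M y z < min (?a / k) (b - rdist M xs y)"
    using assms(2) small by (simp add: field_simps)
  then obtain \<gamma> where \<gamma>: "pw_C1_curve M \<gamma>" "\<gamma> 0 = y" "\<gamma> 1 = z"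
    and len: "curve_length M \<gamma> < min (?a / k) (b - rdist M xs y)"
    by (rule rdist_curveE)
  have C1: "pw_C1_on M 0 1 \<gamma>"
    using \<gamma>(1) by (simp add: pw_C1_curve_iff)
  have "\<gamma> t \<in> rcball M xs b" if t: "t \<in> {0..1}" for t
  proof (rule rcball_I)
    have "rdist M y (\<gamma> t) \<le> integral {0..t} (speed M \<gamma>)"
      using rdist_le_integral[OF pw_C1_on_subinterval[OF C1, of 0 t]] t \<gamma>(2) by simp
    also have "\<dots> \<le> curve_length M \<gamma>"
      unfolding curve_length_eq
      by (rule integral_subset_le)
        (use t in \<open>auto intro!: speed_integrable pw_C1_on_subinterval[OF C1] simp: speed_nonneg\<close>)
    finally show "rdist M xs (\<gamma> t) \<le> b"
      using rdist_triangle[of xs "\<gamma> t" y] len by simp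
  qed
  then have "?a \<le> k * curve_length M \<gamma>"
    using Rinv_le_curve_length[OF \<gamma>(1), of k] k \<gamma>(2,3) assms(2) by auto
  then show False
    using len assms(2) by (simp add: field_simps)
qed

end

section \<open>Eigenvalues of the metric matrix\<close>

text \<open>A minimiser of the Rayleigh quotient on the compact unit sphere is an
  eigenvector.\<close>

lemma least_eigenvalue:
  fixes A :: "real^'n^'n"
  assumes sym: "\<And>v w. v \<bullet> (A *v w) = w \<bullet> (A *v v)"
  obtains l where "matrix_eigenvalue A l" "\<And>w. l * (norm w)\<^sup>2 \<le> w \<bullet> (A *v w)"
proof -
  have "continuous_on (sphere 0 1) (\<lambda>w. w \<bullet> (A *v w))"
    by (intro continuous_intros matrix_vector_mult_linear_continuous_on)
  moreover have "sphere (0::real^'n) 1 \<noteq> {}"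
    by simp
  ultimately obtain w0 where w0: "w0 \<in> sphere 0 1" "\<And>w. w \<in> sphere 0 1 \<Longrightarrow> w0 \<bullet> (A *v w0) \<le> w \<bullet> (A *v w)"
    using continuous_attains_inf[OF compact_sphere, of 0 1 "\<lambda>w. w \<bullet> (A *v w)"] by auto
  define l where "l = w0 \<bullet> (A *v w0)"
  have le: "l * (norm w)\<^sup>2 \<le> w \<bullet> (A *v w)" for w
  proof (cases "w = 0")
    case False
    have "l \<le> ((1 / norm w) *\<^sub>R w) \<bullet> (A *v ((1 / norm w) *\<^sub>R w))"
      unfolding l_def using False by (intro w0(2)) auto
    also have "\<dots> = (w \<bullet> (A *v w)) / (norm w)\<^sup>2"
      by (simp add: matrix_vector_mult_scaleR power2_eq_square)
    finally show ?thesis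
      using False by (simp add: field_simps)
  qed simp
  \<comment> \<open>\<open>q\<close> is a nonnegative quadratic form that vanishes at
    \<open>w0\<close>, and \<open>z\<close> below is half its gradient there. If \<open>z\<close>
    were nonzero, a short move along \<open>- z\<close> would make \<open>q\<close>
    negative.\<close>
  define q where "q w = w \<bullet> (A *v w) - l * (w \<bullet> w)" for w
  have q: "q w \<ge> 0" for w
    using le[of w] by (simp add: q_def power2_norm_eq_inner)
  define z where "z = A *v w0 - l *\<^sub>R w0"
  have w0_1: "w0 \<bullet> w0 = 1"
    using w0(1) by (simp add: norm_eq_1)
  have q_line: "q (w0 + t *\<^sub>R z) = 2 * t * (z \<bullet> z) + t\<^sup>2 * q z" for t
  proof -
    have "z \<bullet> (A *v w0) = z \<bullet> z + l * (w0 \<bullet> z)" "w0 \<bullet> (A *v w0) = l"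
      by (simp_all add: z_def l_def algebra_simps inner_commute)
    then show ?thesis
      using sym[of w0 z] w0_1
      by (simp add: q_def algebra_simps matrix_vector_right_distrib matrix_vector_mult_scaleR
          power2_eq_square inner_commute[of z w0])
  qed
  have "z \<bullet> z = 0"
  proof (rule ccontr)
    assume "z \<bullet> z \<noteq> 0"
    then have p: "z \<bullet> z > 0"
      using inner_ge_zero[of z] by linarith
    have qz: "q z + 1 > 0"
      using q[of z] by linarith
    \<comment> \<open>A step length for which the linear term dominates; the summand 1 avoids a
      division by zero when \<open>q z = 0\<close>.\<close>
    define a where "a = (z \<bullet> z) / (q z + 1)"
    have a: "a > 0" "z \<bullet> z = a * (q z + 1)"
      using p qz by (simp_all add: a_def)
    have "2 * (- a) * (z \<bullet> z) + (- a)\<^sup>2 * q z = a\<^sup>2 * (q z - 2 * (q z + 1))"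
      unfolding a(2) by (simp add: algebra_simps power2_eq_square)
    also have "\<dots> < 0"
      using a(1) q[of z] by (intro mult_pos_neg) auto
    finally show False
      using q[of "w0 + (- a) *\<^sub>R z"] q_line[of "- a"] by simp
  qed
  then have "A *v w0 = l *\<^sub>R w0"
    by (simp add: z_def)
  moreover have "w0 \<noteq> 0"
    using w0(1) by auto
  ultimately show ?thesis
    using that le unfolding matrix_eigenvalue_def by blast
qed

lemma greatest_eigenvalue:
  fixes A :: "real^'n^'n"
  assumes sym: "\<And>v w. v \<bullet> (A *v w) = w \<bullet> (A *v v)"
  obtains l where "matrix_eigenvalue A l" "\<And>w. w \<bullet> (A *v w) \<le> l * (norm w)\<^sup>2"
proof -
  have neg: "(- A) *v w = - (A *v w)" for w
    by (simp add: matrix_vector_mult_def vec_eq_iff sum_negf)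
  obtain l where l: "matrix_eigenvalue (- A) l" "\<And>w. l * (norm w)\<^sup>2 \<le> w \<bullet> ((- A) *v w)"
    by (rule least_eigenvalue[of "- A"]) (use sym in \<open>auto simp: neg\<close>)
  have "matrix_eigenvalue A (- l)"
    using l(1) unfolding matrix_eigenvalue_def neg by (metis minus_minus scaleR_minus_left)
  moreover have "w \<bullet> (A *v w) \<le> - l * (norm w)\<^sup>2" for w
    using l(2)[of w] by (simp add: neg)
  ultimately show ?thesis
    by (rule that)
qed

section \<open>Orthonormal frames and the eigenvalue bounds for the differential\<close>

context connected_riemannian
begin

lemma metric_sum_left: "metric M y (\<Sum>i\<in>S. v i) w = (\<Sum>i\<in>S. metric M y (v i) w)"
proof -
  have "linear (\<lambda>v. metric M y v w)"
    using metric_bilinear[of y] by (simp add: bilinear_def)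
  from linear_sum[OF this] show ?thesis .
qed

lemma metric_scaleR_left: "metric M y (a *\<^sub>R v) w = a * metric M y v w"
  by (rule bilinear_lmul[OF metric_bilinear, unfolded real_scaleR_def])

lemma metric_diff_left: "metric M y (v - v') w = metric M y v w - metric M y v' w"
  by (rule bilinear_lsub[OF metric_bilinear])

text \<open>Gram-Schmidt by induction over sets of indices; a dimension count supplies a vector
  outside the span of those already found.\<close>

lemma orthonormal_frame_exists: "\<exists>e. orthonormal_frame M y e"
proof -
  have "\<exists>e. \<forall>i\<in>S. \<forall>j\<in>S. metric M y (e i) (e j) = (if i = j then 1 else 0)" for S :: "'n set"
    using finite[of S]
  proof (induction S rule: finite_induct)
    case (insert k S)
    then obtain e where e: "\<And>i j. i \<in> S \<Longrightarrow> j \<in> S \<Longrightarrow> metric M y (e i) (e j) = (if i = j then 1 else 0)"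
      by blast
    have "dim (e ` S) \<le> card (e ` S)"
      by (intro dim_le_card') simp
    also have "\<dots> \<le> card S"
      by (rule card_image_le) simp
    also have "\<dots> < CARD('n)"
      using insert.hyps by (intro psubset_card_mono) auto
    finally have "span (e ` S) \<noteq> UNIV"
      by (metis dim_span dim_UNIV DIM_cart DIM_real less_irrefl mult_1_right)
    then obtain v where v: "v \<notin> span (e ` S)"
      by blast
    define w where "w = v - (\<Sum>j\<in>S. metric M y v (e j) *\<^sub>R e j)"
    have "(\<Sum>j\<in>S. metric M y v (e j) *\<^sub>R e j) \<in> span (e ` S)"
      by (intro span_sum span_scale span_base) auto
    then have "w \<noteq> 0"
      using v by (auto simp: w_def)
    then have tw: "tnorm M y w \<noteq> 0"
      by (simp add: tnorm_eq_0)
    have orth: "metric M y w (e j) = 0" if "j \<in> S" for j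
    proof -
      have "(\<Sum>i\<in>S. metric M y v (e i) * metric M y (e i) (e j)) = (\<Sum>i\<in>S. if i = j then metric M y v (e j) else 0)"
        using that by (intro sum.cong) (auto simp: e)
      then show ?thesis
        using that insert.hyps by (simp add: w_def metric_diff_left metric_sum_left metric_scaleR_left)
    qed
    define e' where "e' = e(k := (1 / tnorm M y w) *\<^sub>R w)"
    have "metric M y (e' i) (e' j) = (if i = j then 1 else 0)" if ij: "i \<in> insert k S" "j \<in> insert k S" for i j
    proof (cases "i = k"; cases "j = k")
      assume "i = k" "j = k"
      then show ?thesis
        using tw tnorm_square[of y "e' k"] by (simp add: e'_def tnorm_scaleR)
    next
      assume "i = k" "j \<noteq> k"
      then show ?thesis
        using ij orth by (auto simp: e'_def metric_scaleR_left)
    next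
      assume "i \<noteq> k" "j = k"
      then show ?thesis
        using ij orth metric_sym[of y "e i"] by (auto simp: e'_def metric_scaleR_left)
    next
      assume "i \<noteq> k" "j \<noteq> k"
      then show ?thesis
        using ij e by (auto simp: e'_def)
    qed
    then show ?case
      by blast
  qed auto
  from this[of UNIV] show ?thesis
    by (auto simp: orthonormal_frame_def)
qed

text \<open>The linear isometry from Euclidean coordinates to the tangent space; it translates
  statements about matrices into statements about \<open>tnorm\<close>.\<close>

definition frame_map :: "('n \<Rightarrow> real^'n) \<Rightarrow> real^'n \<Rightarrow> real^'n" where
  "frame_map e w = (\<Sum>i\<in>UNIV. w $ i *\<^sub>R e i)"

lemma frame_map_linear: "linear (frame_map e)"
  by (intro linearI) (simp_all add: frame_map_def scaleR_add_left sum.distrib scaleR_sum_right)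

lemma metric_frame_map:
  assumes e: "orthonormal_frame M y e"
  shows "metric M y (frame_map e w) (e j) = w $ j"
proof -
  have "(\<Sum>i\<in>UNIV. w $ i * metric M y (e i) (e j)) = (\<Sum>i\<in>UNIV. if i = j then w $ j else 0)"
    using e by (intro sum.cong) (auto simp: orthonormal_frame_def)
  then show ?thesis
    by (simp add: frame_map_def metric_sum_left metric_scaleR_left)
qed

lemma tnorm_frame_map:
  assumes e: "orthonormal_frame M y e"
  shows "(tnorm M y (frame_map e w))\<^sup>2 = (norm w)\<^sup>2"
proof -
  have "metric M y (frame_map e w) (frame_map e w) = (\<Sum>i\<in>UNIV. w $ i * metric M y (e i) (frame_map e w))"
    by (subst (1) frame_map_def) (simp add: metric_sum_left metric_scaleR_left)
  also have "\<dots> = (\<Sum>i\<in>UNIV. w $ i * w $ i)"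
    using metric_frame_map[OF e] by (simp add: metric_sym[of y "e _"])
  also have "\<dots> = (norm w)\<^sup>2"
    by (simp add: power2_norm_eq_inner inner_vec_def)
  finally show ?thesis
    by (simp add: tnorm_square)
qed

lemma frame_map_surj:
  assumes e: "orthonormal_frame M y e"
  shows "surj (frame_map e)"
proof (rule linear_inj_imp_surj[OF frame_map_linear])
  show "inj (frame_map e)"
  proof (rule injI)
    fix v w assume "frame_map e v = frame_map e w"
    then have "v $ j = w $ j" for j
      by (metis metric_frame_map[OF e])
    then show "v = w"
      by (simp add: vec_eq_iff)
  qed
qed

end

context retraction_ball
begin

text \<open>The matrix represents the metric pulled back by \<open>dR\<close>. In this form its
  eigenvalues bound the distortion of norms by \<open>dR\<close>.\<close>

lemma metric_matrix_form:
  assumes "R y u = z" "Rinv R U y z = u"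
  shows "v \<bullet> (metric_matrix M R U e y z *v w) =
    metric M z (dR M R y u (frame_map e v)) (dR M R y u (frame_map e w))"
proof -
  have dR: "dR M R y u (frame_map e w) = (\<Sum>i\<in>UNIV. w $ i *\<^sub>R dR M R y u (e i))" for w
    by (simp add: frame_map_def linear_sum[OF dR_linear] linear_cmul[OF dR_linear])
  have right: "metric M z a (dR M R y u (frame_map e w)) = (\<Sum>j\<in>UNIV. w $ j * metric M z a (dR M R y u (e j)))" for a
    unfolding metric_sym[of z a] dR by (simp add: metric_sum_left metric_scaleR_left)
  have "metric M z (dR M R y u (frame_map e v)) (dR M R y u (frame_map e w)) =
    (\<Sum>i\<in>UNIV. v $ i * metric M z (dR M R y u (e i)) (dR M R y u (frame_map e w)))"
    unfolding dR[of v] by (simp add: metric_sum_left metric_scaleR_left)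
  also have "\<dots> = (\<Sum>i\<in>UNIV. v $ i * (\<Sum>j\<in>UNIV. w $ j * metric M z (dR M R y u (e i)) (dR M R y u (e j))))"
    unfolding right ..
  also have "\<dots> = v \<bullet> (metric_matrix M R U e y z *v w)"
    by (simp add: inner_vec_def metric_matrix_def matrix_vector_mult_def assms(2) mult.commute)
  finally show ?thesis ..
qed

lemma metric_comparison:
  assumes "0 \<le> b"
    and lmin: "lmin \<in> metric_eigenvalues M R U (rcball M xs b)"
      "\<And>l. l \<in> metric_eigenvalues M R U (rcball M xs b) \<Longrightarrow> lmin \<le> l"
    and lmax: "\<And>l. l \<in> metric_eigenvalues M R U (rcball M xs b) \<Longrightarrow> l \<le> lmax"
  defines "c \<equiv> sqrt (lmax / lmin)"
  shows "1 \<le> c"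
    and "y \<in> rcball M xs b \<Longrightarrow> u \<in> U y \<Longrightarrow> R y u \<in> rcball M xs b \<Longrightarrow>
      tnorm M (R y u) (dR M R y u v) \<le> c * tnorm M y v"
    and "y \<in> rcball M xs b \<Longrightarrow> u \<in> U y \<Longrightarrow> R y u \<in> rcball M xs b \<Longrightarrow>
      tnorm M y v \<le> c * tnorm M (R y u) (dR M R y u v)"
proof -
  let ?B = "rcball M xs b"
  have bounds: "lmin * (tnorm M y v)\<^sup>2 \<le> (tnorm M (R y u) (dR M R y u v))\<^sup>2 \<and>
      (tnorm M (R y u) (dR M R y u v))\<^sup>2 \<le> lmax * (tnorm M y v)\<^sup>2"
    if y: "y \<in> ?B" "u \<in> U y" "R y u \<in> ?B" for y u v
  proof -
    obtain e where e: "orthonormal_frame M y e"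
      using orthonormal_frame_exists by blast
    obtain w where w: "v = frame_map e w"
      using frame_map_surj[OF e] by (auto elim: surjE)
    let ?A = "metric_matrix M R U e y (R y u)"
    have form: "v \<bullet> (?A *v w) = metric M (R y u) (dR M R y u (frame_map e v)) (dR M R y u (frame_map e w))" for v w
      by (rule metric_matrix_form[OF refl Rinv_R[OF y(1,2)]])
    have sym: "v \<bullet> (?A *v w) = w \<bullet> (?A *v v)" for v w
      unfolding form by (rule metric_sym)
    have ev: "l \<in> metric_eigenvalues M R U ?B" if "matrix_eigenvalue ?A l" for l
      using y(1,3) e that unfolding metric_eigenvalues_def by blast
    obtain l where l: "matrix_eigenvalue ?A l" "\<And>w. l * (norm w)\<^sup>2 \<le> w \<bullet> (?A *v w)"
      using least_eigenvalue[OF sym] by blast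
    obtain l' where l': "matrix_eigenvalue ?A l'" "\<And>w. w \<bullet> (?A *v w) \<le> l' * (norm w)\<^sup>2"
      using greatest_eigenvalue[OF sym] by blast
    have "lmin * (norm w)\<^sup>2 \<le> l * (norm w)\<^sup>2" "l' * (norm w)\<^sup>2 \<le> lmax * (norm w)\<^sup>2"
      using lmin(2)[OF ev[OF l(1)]] lmax[OF ev[OF l'(1)]] by (simp_all add: mult_right_mono)
    then show ?thesis
      using l(2)[of w] l'(2)[of w] unfolding form
      by (simp add: tnorm_square[of "R y u"] w tnorm_frame_map[OF e])
  qed
  \<comment> \<open>Since \<open>lmin\<close> is itself an eigenvalue, its positivity can be read
    off an eigenvector: the pulled-back metric is definite because \<open>dR\<close> is
    injective.\<close>
  obtain y z e w where y: "y \<in> ?B" "z \<in> ?B" and e: "orthonormal_frame M y e"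
    and w: "w \<noteq> 0" "metric_matrix M R U e y z *v w = lmin *\<^sub>R w"
    using lmin(1) unfolding metric_eigenvalues_def matrix_eigenvalue_def by blast
  define u where "u = Rinv R U y z"
  have z: "z \<in> R y ` U y"
    using U_ball y by blast
  have "lmin * (norm w)\<^sup>2 = metric M z (dR M R y u (frame_map e w)) (dR M R y u (frame_map e w))"
    using metric_matrix_form[OF R_Rinv[OF z] refl, of w e w] w(2)
    by (simp add: u_def power2_norm_eq_inner)
  also have "\<dots> > 0"
  proof (rule metric_pos)
    have "tnorm M y (frame_map e w) \<noteq> 0"
      using tnorm_frame_map[OF e, of w] w(1) by auto
    then show "dR M R y u (frame_map e w) \<noteq> 0"
      using dR_injective[OF y(1), of u] Rinv_in[OF z] tnorm_eq_0 by (auto simp: u_def)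
  qed
  finally have lmin_pos: "lmin > 0"
    using w(1) by (simp add: zero_less_mult_iff)
  have xs: "xs \<in> ?B"
    using assms(1) by (simp add: rcball_def)
  \<comment> \<open>At \<open>xs\<close> and the zero vector the differential is the identity,
    whence \<open>lmin \<le> 1 \<le> lmax\<close>. So \<open>lmax\<close> and
    \<open>1 / lmin\<close> are both at most \<open>lmax / lmin\<close>, and the single constant
    \<open>c\<close> serves for \<open>dR\<close> and its inverse.\<close>
  have "((snd (chart_at M xs) \<circ> R xs) has_derivative id) (at 0)"
    using retr by (simp add: retraction_on_def)
  from frechet_derivative_at[OF this] have dR0: "dR M R xs 0 v = v" for v
    by (simp add: dR_eq id_def fun_eq_iff)
  obtain v :: "real^'n" where "v \<noteq> 0"
    using nonempty_Basis nonzero_Basis by blast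
  then have "(tnorm M xs v)\<^sup>2 > 0"
    using tnorm_eq_0 by simp
  moreover have "lmin * (tnorm M xs v)\<^sup>2 \<le> 1 * (tnorm M xs v)\<^sup>2 \<and> 1 * (tnorm M xs v)\<^sup>2 \<le> lmax * (tnorm M xs v)\<^sup>2"
    using bounds[OF xs, of 0 v] U[OF xs] xs by (simp add: dR0)
  ultimately have l1: "lmin \<le> 1" "1 \<le> lmax"
    using mult_le_cancel_right_pos by blast+
  have c2: "c\<^sup>2 = lmax / lmin"
    using lmin_pos l1 by (simp add: c_def)
  have c_ge: "lmax \<le> c\<^sup>2" "1 / lmin \<le> c\<^sup>2" "0 \<le> c" "1 \<le> c\<^sup>2"
    unfolding c2 using lmin_pos l1 by (simp_all add: field_simps c_def mult_left_le)
  show "1 \<le> c"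
    using c_ge(3,4) power2_le_imp_le[of 1 c] by simp
  show "tnorm M (R y u) (dR M R y u v) \<le> c * tnorm M y v"
    if "y \<in> ?B" "u \<in> U y" "R y u \<in> ?B" for y u v
  proof (rule power2_le_imp_le)
    have "(tnorm M (R y u) (dR M R y u v))\<^sup>2 \<le> lmax * (tnorm M y v)\<^sup>2"
      using bounds[OF that] by blast
    also have "\<dots> \<le> c\<^sup>2 * (tnorm M y v)\<^sup>2"
      by (intro mult_right_mono c_ge) simp
    finally show "(tnorm M (R y u) (dR M R y u v))\<^sup>2 \<le> (c * tnorm M y v)\<^sup>2"
      by (simp add: power_mult_distrib)
  qed (use c_ge in simp)
  show "tnorm M y v \<le> c * tnorm M (R y u) (dR M R y u v)"
    if "y \<in> ?B" "u \<in> U y" "R y u \<in> ?B" for y u v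
  proof (rule power2_le_imp_le)
    have "(tnorm M y v)\<^sup>2 \<le> 1 / lmin * (tnorm M (R y u) (dR M R y u v))\<^sup>2"
      using bounds[OF that, of v] lmin_pos by (simp add: field_simps)
    also have "\<dots> \<le> c\<^sup>2 * (tnorm M (R y u) (dR M R y u v))\<^sup>2"
      by (intro mult_right_mono c_ge) simp
    finally show "(tnorm M y v)\<^sup>2 \<le> (c * tnorm M (R y u) (dR M R y u v))\<^sup>2"
      by (simp add: power_mult_distrib)
  qed (use c_ge in simp)
qed

end

section \<open>Convergence of the iteration\<close>

context connected_riemannian
begin

text \<open>\<open>grad\<close> is a definite description. An orthonormal frame provides the
  representing vector, and definiteness of the metric its uniqueness.\<close>

lemma metric_grad:
  assumes lin: "linear (differential M h y)"
  shows "metric M y (grad M h y) v = differential M h y v"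
proof -
  obtain e where e: "orthonormal_frame M y e"
    using orthonormal_frame_exists by blast
  define w where "w = (\<Sum>i\<in>UNIV. differential M h y (e i) *\<^sub>R e i)"
  have w: "metric M y w v = differential M h y v" for v
  proof -
    obtain a where a: "v = frame_map e a"
      using frame_map_surj[OF e] by (auto elim: surjE)
    have "metric M y w v = (\<Sum>i\<in>UNIV. differential M h y (e i) * a $ i)"
      by (simp add: w_def metric_sum_left metric_scaleR_left metric_sym[of y "e _"] a metric_frame_map[OF e])
    also have "\<dots> = differential M h y v"
      by (simp add: a frame_map_def linear_sum[OF lin] linear_cmul[OF lin] mult.commute)
    finally show ?thesis .
  qed
  have "w' = w" if "\<forall>v. metric M y w' v = differential M h y v" for w'
  proof (rule ccontr)
    assume "w' \<noteq> w"
    then have "metric M y (w' - w) (w' - w) > 0"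
      by (intro metric_pos) simp
    then show False
      using that w by (simp add: metric_diff_left)
  qed
  then have "\<forall>v. metric M y (grad M h y) v = differential M h y v"
    unfolding grad_def by (rule theI[of "\<lambda>w. \<forall>v. metric M y w v = differential M h y v", rotated]) (simp_all add: w)
  then show ?thesis
    by blast
qed

text \<open>This is \<open>grad f = J^* F\<close>, tested against a vector \<open>v\<close>.\<close>

lemma metric_grad_half_sq:
  assumes F: "C1_map M F"
  shows "metric M y (grad M (half_sq F) y) v = F y \<bullet> jac M F y v"
proof -
  let ?\<kappa> = "chart_at M y"
  let ?p = "snd ?\<kappa> y"
  have p: "?p \<in> chart_image ?\<kappa>" "chart_inv ?\<kappa> ?p = y"
    using chart_inverse(1,2)[OF chart_at(1)] chart_at(2) by auto
  define D where "D = frechet_derivative (F \<circ> chart_inv ?\<kappa>) (at ?p)"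
  have "(F \<circ> chart_inv ?\<kappa>) differentiable (at ?p)"
    using F chart_at(1)[of y] Ck_on_1D(1)[OF _ p(1)] unfolding C1_map_def by blast
  then have D: "((F \<circ> chart_inv ?\<kappa>) has_derivative D) (at ?p)"
    unfolding D_def frechet_derivative_works .
  have "(((\<lambda>z. F z $ i) \<circ> chart_inv ?\<kappa>) has_derivative (\<lambda>v. D v $ i)) (at ?p)" for i
    using bounded_linear.has_derivative[OF bounded_linear_vec_nth D] by (simp add: o_def)
  from frechet_derivative_at[OF this]
  have di: "differential M (\<lambda>z. F z $ i) y = (\<lambda>v. D v $ i)" for i
    by (simp add: differential_def fun_eq_iff)
  have "linear (\<lambda>v. D v $ i)" for i
    using linear_compose[OF has_derivative_linear[OF D] bounded_linear.linear[OF bounded_linear_vec_nth]] by (simp add: o_def)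
  then have jac: "jac M F y v = D v" for v
    unfolding jac_def by (subst metric_grad) (simp_all add: di)
  have sq: "half_sq F \<circ> chart_inv ?\<kappa> = (\<lambda>q. ((F \<circ> chart_inv ?\<kappa>) q \<bullet> (F \<circ> chart_inv ?\<kappa>) q) / 2)"
    by (simp add: fun_eq_iff half_sq_def power2_norm_eq_inner)
  have "((half_sq F \<circ> chart_inv ?\<kappa>) has_derivative (\<lambda>v. F y \<bullet> D v)) (at ?p)"
    unfolding sq by (rule derivative_eq_intros D refl)+ (simp_all add: p(2) inner_commute fun_eq_iff)
  from frechet_derivative_at[OF this]
  have df: "differential M (half_sq F) y = (\<lambda>v. F y \<bullet> D v)"
    by (simp add: differential_def fun_eq_iff)
  have "linear (\<lambda>v. F y \<bullet> D v)"
    using linear_compose[OF has_derivative_linear[OF D] bounded_linear.linear[OF bounded_linear_inner_right]]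
    by (simp add: o_def)
  then show ?thesis
    by (subst metric_grad) (simp_all add: df jac)
qed

text \<open>A zero of \<open>F\<close> is automatically critical by \<open>grad f = J^* F\<close>,
  so only the condition on the value of \<open>f\<close> remains.\<close>

lemma zero_in_sol_set:
  assumes F: "C1_map M F" and "half_sq F xs = 0"
  shows "y \<in> sol_set M F xs \<longleftrightarrow> F y = 0"
proof
  assume "y \<in> sol_set M F xs"
  then show "F y = 0"
    using assms(2) by (simp add: sol_set_def half_sq_def)
next
  assume y: "F y = 0"
  then have "metric M y (grad M (half_sq F) y) (grad M (half_sq F) y) = 0"
    by (simp add: metric_grad_half_sq[OF F])
  then have "grad M (half_sq F) y = 0"
    using metric_pos[of "grad M (half_sq F) y" y] by fastforce
  then show "y \<in> sol_set M F xs"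
    using y assms(2) by (simp add: sol_set_def half_sq_def)
qed

end

lemma dist_to_nearest:
  assumes "is_nearest M S y z"
  shows "dist_to M y S = rdist M y z"
  unfolding dist_to_def using assms by (intro cInf_eq_minimum) (auto simp: is_nearest_def)

lemma lm_step_bounds:
  fixes f fs fv ns nv m c1 c2 L :: real
  assumes nonneg: "0 \<le> f" "0 \<le> fs" "0 \<le> fv" "0 \<le> ns" "0 \<le> nv"
    and pos: "0 < c1" "0 < c2" "0 < L" "0 < m0"
    and model: "fs\<^sup>2 + m * f\<^sup>2 * ns\<^sup>2 \<le> fv\<^sup>2 + m * f\<^sup>2 * nv\<^sup>2"
    and fv: "fv \<le> c1 * nv\<^sup>2" and f: "c2 * nv \<le> f" "f \<le> L * nv" and m: "m0 \<le> m" "m \<le> m1"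
  shows "fs \<le> sqrt (c1\<^sup>2 + L\<^sup>2 * m1) * nv\<^sup>2"
    and "0 < f \<Longrightarrow> ns \<le> sqrt ((c1\<^sup>2 + c2\<^sup>2 * m0) / (c2\<^sup>2 * m0)) * nv"
proof -
  have fv2: "fv\<^sup>2 \<le> c1\<^sup>2 * (nv\<^sup>2)\<^sup>2"
    using power_mono[OF fv nonneg(3), of 2] by (simp add: power_mult_distrib)
  have f2: "f\<^sup>2 \<le> L\<^sup>2 * nv\<^sup>2" "c2\<^sup>2 * nv\<^sup>2 \<le> f\<^sup>2"
    using power_mono[OF f(2) nonneg(1), of 2] power_mono[OF f(1), of 2] pos(2) nonneg(5)
    by (simp_all add: power_mult_distrib)
  have m_pos: "0 < m" "0 < m1"
    using m pos(4) by linarith+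
  show "fs \<le> sqrt (c1\<^sup>2 + L\<^sup>2 * m1) * nv\<^sup>2"
  proof (rule power2_le_imp_le)
    have "fs\<^sup>2 \<le> fs\<^sup>2 + m * f\<^sup>2 * ns\<^sup>2"
      using m_pos by simp
    also have "\<dots> \<le> c1\<^sup>2 * (nv\<^sup>2)\<^sup>2 + m1 * (L\<^sup>2 * nv\<^sup>2) * nv\<^sup>2"
      using model fv2 mult_right_mono[OF mult_mono[OF m(2) f2(1)], of "nv\<^sup>2"] m_pos by simp
    also have "\<dots> = (sqrt (c1\<^sup>2 + L\<^sup>2 * m1) * nv\<^sup>2)\<^sup>2"
      using m_pos by (simp add: power_mult_distrib real_sqrt_pow2 algebra_simps)
    finally show "fs\<^sup>2 \<le> (sqrt (c1\<^sup>2 + L\<^sup>2 * m1) * nv\<^sup>2)\<^sup>2" .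
  qed (use m_pos in auto)
  assume "0 < f"
  then have nv: "0 < nv"
    using f(2) nonneg(5) pos(3) by (cases "nv = 0") auto
  show "ns \<le> sqrt ((c1\<^sup>2 + c2\<^sup>2 * m0) / (c2\<^sup>2 * m0)) * nv"
  proof (rule power2_le_imp_le)
    have "c2\<^sup>2 * m0 * (ns\<^sup>2 - nv\<^sup>2) \<le> c1\<^sup>2 * nv\<^sup>2"
    \<comment> \<open>Replacing \<open>m * f^2\<close> by its lower bound is legitimate only when
      its cofactor \<open>ns^2 - nv^2\<close> is nonnegative; otherwise the left-hand side is
      nonpositive anyway.\<close>
    proof (cases "ns\<^sup>2 \<le> nv\<^sup>2")
      case True
      then have "c2\<^sup>2 * m0 * (ns\<^sup>2 - nv\<^sup>2) \<le> 0"
        using pos by (simp add: mult_nonneg_nonpos)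
      then show ?thesis
        using zero_le_mult_iff[of "c1\<^sup>2" "nv\<^sup>2"] by (smt (verit) zero_le_power2)
    next
      case False
      have "m0 * (c2\<^sup>2 * nv\<^sup>2) * (ns\<^sup>2 - nv\<^sup>2) \<le> m * f\<^sup>2 * (ns\<^sup>2 - nv\<^sup>2)"
        using False m(1) f2(2) pos m_pos by (intro mult_right_mono mult_mono) auto
      also have "\<dots> \<le> c1\<^sup>2 * (nv\<^sup>2)\<^sup>2"
        using model fv2 zero_le_power2[of fs] unfolding right_diff_distrib by linarith
      finally have "nv\<^sup>2 * (c2\<^sup>2 * m0 * (ns\<^sup>2 - nv\<^sup>2)) \<le> nv\<^sup>2 * (c1\<^sup>2 * nv\<^sup>2)"
        by (simp add: algebra_simps power2_eq_square)
      then show ?thesis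
        using nv by (subst (asm) mult_le_cancel_left_pos) auto
    qed
    then have "ns\<^sup>2 \<le> (c1\<^sup>2 + c2\<^sup>2 * m0) / (c2\<^sup>2 * m0) * nv\<^sup>2"
      using pos by (simp add: field_simps)
    then show "ns\<^sup>2 \<le> (sqrt ((c1\<^sup>2 + c2\<^sup>2 * m0) / (c2\<^sup>2 * m0)) * nv)\<^sup>2"
      using pos by (simp add: power_mult_distrib)
  qed (use nv pos in auto)
qed

lemma rlm_mu_lower_bound:
  assumes "rlm_sequence M R F \<eta> \<mu>min \<beta> x \<mu> s" "0 < \<mu>min" "1 < \<beta>"
  shows "\<mu>min \<le> \<mu> k"
proof (induction k)
  case (Suc k)
  have "\<mu> k \<le> \<beta> * \<mu> k"
    using Suc assms(2,3) by simp
  moreover have "\<mu> (Suc k) = max \<mu>min (\<mu> k / \<beta>) \<or> \<mu> (Suc k) = \<beta> * \<mu> k"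
    using assms(1) unfolding rlm_sequence_def by metis
  ultimately show ?case
    using Suc by auto
qed (use assms in \<open>simp add: rlm_sequence_def\<close>)

theorem theorem3:
  fixes M :: "('a::{t2_space,second_countable_topology}, 'n::finite) riem"
    and R :: "'a \<Rightarrow> real^'n \<Rightarrow> 'a"
    and F :: "'a \<Rightarrow> real^'m::finite"
    and U :: "'a \<Rightarrow> (real^'n) set"
    and nearest :: "'a \<Rightarrow> 'a"
    and x :: "nat \<Rightarrow> 'a" and \<mu> :: "nat \<Rightarrow> real" and s :: "nat \<Rightarrow> real^'n"
    and xs :: 'a
    and \<eta> \<mu>min \<beta> \<mu>max b c1 c2 L lmin lmax c c3 c4 c5 cs rs bs r :: real
  assumes manifold: "riemannian_manifold M"
    and connected: "connected (UNIV :: 'a set)"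
    and complete: "rcomplete M"
    and F_C1: "C1_map M F"
    and retr: "retraction_on M R"
    and inputs: "0 < \<eta>" "\<eta> < 1" "0 < \<mu>min" "1 < \<beta>"
    and run: "rlm_sequence M R F \<eta> \<mu>min \<beta> x \<mu> s"
    and zero: "half_sq F xs = 0"
    and nearest: "\<And>y. is_nearest M (sol_set M F xs) y (nearest y)"
    and b_pos: "0 < b"
    \<comment> \<open>the local inverses of the retraction and their domains of definition\<close>
    and U: "\<And>y. y \<in> rcball M xs b \<Longrightarrow> 0 \<in> U y \<and> diffeo_onto_image M (R y) (U y)"
    and U_ball: "\<And>y. y \<in> rcball M xs b \<Longrightarrow> rcball M xs b \<subseteq> R y ` U y"
    and U_nearest: "\<And>y. y \<in> rcball M xs b \<Longrightarrow> nearest y \<in> R y ` U y"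
    \<comment> \<open>conditions (a), (b), (c)\<close>
    and c1: "0 < c1"
      "\<And>y z. y \<in> rcball M xs b \<Longrightarrow> z \<in> rcball M xs b \<Longrightarrow>
         norm (jac M F y (Rinv R U y z) - (F z - F y)) \<le> c1 * (tnorm M y (Rinv R U y z))\<^sup>2"
    and c2: "0 < c2"
      "\<And>y. y \<in> rcball M xs b \<Longrightarrow>
         c2 * tnorm M y (Rinv R U y (nearest y)) \<le> norm (F y - F (nearest y))"
    and \<mu>max: "0 < \<mu>max" "\<And>k. \<mu> k \<le> \<mu>max"
    \<comment> \<open>constants\<close>
    and lmin: "lmin \<in> metric_eigenvalues M R U (rcball M xs b)"
      "\<And>l. l \<in> metric_eigenvalues M R U (rcball M xs b) \<Longrightarrow> lmin \<le> l"
    and lmax: "lmax \<in> metric_eigenvalues M R U (rcball M xs b)"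
      "\<And>l. l \<in> metric_eigenvalues M R U (rcball M xs b) \<Longrightarrow> l \<le> lmax"
    and c_eq: "c = sqrt (lmax / lmin)"
    and L: "0 < L"
      "\<And>y z. y \<in> rcball M xs b \<Longrightarrow> z \<in> rcball M xs b \<Longrightarrow>
         norm (F z - F y) \<le> L * tnorm M y (Rinv R U y z)"
    and c3_eq: "c3 = sqrt ((c1\<^sup>2 + c2\<^sup>2 * \<mu>min) / (c2\<^sup>2 * \<mu>min))"
    and c4_eq: "c4 = sqrt (c1\<^sup>2 + L\<^sup>2 * \<mu>max)"
    and c5_eq: "c5 = c^3 * (c1 * c3\<^sup>2 + c4) / c2"
    and cs_eq: "cs = (- c * c2 * c4 + sqrt (c\<^sup>2 * c2\<^sup>2 * c4\<^sup>2 + 4 * c\<^sup>2 * \<mu>max * c2\<^sup>2 * c3\<^sup>2 * L\<^sup>2))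
                     / (2 * c\<^sup>2 * \<mu>max * c3\<^sup>2 * L\<^sup>2)"
    \<comment> \<open>smallness of the radius\<close>
    and b_inj: "rcball M xs b \<subseteq> R xs ` {v. ereal (tnorm M xs v) < inj_radius M R xs}"
    and b_c4: "b \<le> 2 * c2 / (c * c4)"
    and b_cs: "b / 2 < cs"
    and rs: "0 < rs"
      "\<And>k. x k \<in> rcball M xs (min (b / 2) rs) \<Longrightarrow> rdist M (x k) xs < cs \<Longrightarrow>
         lm_successful M R F \<eta> (\<mu> k) (x k) (s k)"
    and b_rs: "b / 2 \<le> rs"
    and bs: "0 < bs"
      "\<And>b'. 0 < b' \<Longrightarrow> b' \<le> bs \<Longrightarrow>
         (INF y\<in>rcball M xs (b' / 2). inj_radius M R y) \<ge> ereal (b' * c * c3 / 2)"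
    and b_bs: "b \<le> bs"
    and r_eq: "r = min (b / (2 + 4 * c\<^sup>2 * c3)) (1 / (2 * c5))"
    and x0: "x 0 \<in> rcball M xs r"
  shows "quadratically_to_0 (\<lambda>k. dist_to M (x k) (sol_set M F xs)) \<and>
         (\<exists>xh \<in> rcball M xs (b / 2). rconverges M x xh)"
proof -
  interpret retraction_ball M R U xs b
    by unfold_locales (use manifold connected retr U U_ball in blast)+
  let ?X = "sol_set M F xs"
  let ?v = "\<lambda>y. Rinv R U y (nearest y)"
  define Dist where "Dist k = dist_to M (x k) ?X" for k
  have Dist_eq: "dist_to M y ?X = rdist M y (nearest y)" for y
    using dist_to_nearest[OF nearest] .
  have X: "y \<in> ?X \<longleftrightarrow> F y = 0" for y
    by (rule zero_in_sol_set[OF F_C1 zero])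
  have "F xs = 0"
    using zero by (simp add: half_sq_def)
  then have nearest_le: "rdist M y (nearest y) \<le> rdist M xs y" for y
    using nearest[of y] X[of xs] rdist_sym[of y xs] by (auto simp: is_nearest_def)
  have F_nearest: "F (nearest y) = 0" for y
    using nearest[of y] X by (simp add: is_nearest_def)
  have lmin': "lmin \<le> l" and lmax': "l \<le> lmax" if "l \<in> metric_eigenvalues M R U (rcball M xs b)" for l
    using that lmin(2) lmax(2) by blast+
  have c_ge1: "1 \<le> c"
    unfolding c_eq using b_pos lmin(1) lmin' lmax' by (intro metric_comparison(1)) auto
  have upper: "tnorm M (R y u) (dR M R y u v) \<le> c * tnorm M y v"
    and lower: "tnorm M y v \<le> c * tnorm M (R y u) (dR M R y u v)"
    if "y \<in> rcball M xs b" "u \<in> U y" "R y u \<in> rcball M xs b" for y u v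
    unfolding c_eq using b_pos lmin(1) lmin' lmax' that
    by (intro metric_comparison(2,3); simp)+
  have ray: "v \<in> U y" "R y v \<in> rcball M xs b" "rdist M y (R y v) \<le> c * tnorm M y v"
    if "y \<in> rcball M xs b" "rdist M xs y + c * tnorm M y v < b" for y v
    using that c_ge1 upper by (intro ray_stays[of y c v]; simp)+
  have Rinv_le: "tnorm M y (Rinv R U y z) \<le> c * rdist M y z"
    if "y \<in> rcball M xs b" "rdist M xs y + rdist M y z < b" for y z
    using that c_ge1 lower by (intro Rinv_le_rdist) simp_all
  have \<mu>: "\<mu>min \<le> \<mu> k" "\<mu> k \<le> \<mu>max" for k
    using rlm_mu_lower_bound[OF run inputs(3,4)] \<mu>max by blast+
  have c3_pos: "c3 > 0" and c4_gt: "c4 > c1"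
  proof -
    show "c3 > 0"
      using c1(1) c2(1) inputs(3) by (simp add: c3_eq add_pos_pos)
    have "c1\<^sup>2 < c1\<^sup>2 + L\<^sup>2 * \<mu>max"
      using L(1) \<mu>max(1) by simp
    then show "c4 > c1"
      unfolding c4_eq by (rule real_less_rsqrt)
  qed
  have c5_pos: "c5 > 0"
    using c_ge1 c1(1) c2(1) c3_pos c4_gt by (auto simp: c5_eq intro!: divide_pos_pos mult_pos_pos add_pos_pos)
  have r_pos: "r > 0"
    using b_pos c3_pos c5_pos by (auto simp: r_eq intro!: divide_pos_pos add_pos_pos mult_nonneg_nonneg add_pos_nonneg)

  \<comment> \<open>Distances and residuals in the ball of radius \<open>b / 2\<close>\<close>
  have near: "y \<in> rcball M xs b" "nearest y \<in> rcball M xs b" "tnorm M y (?v y) \<le> c * rdist M y (nearest y)"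
    "rdist M y (nearest y) \<le> c * tnorm M y (?v y)" "c2 * tnorm M y (?v y) \<le> norm (F y)"
    "norm (F y) \<le> L * tnorm M y (?v y)" "norm (F y + jac M F y (?v y)) \<le> c1 * (tnorm M y (?v y))\<^sup>2"
    if y: "rdist M xs y < b / 2" for y
  proof -
    show yB: "y \<in> rcball M xs b"
      using y b_pos by (intro rcball_I) simp
    \<comment> \<open>\<open>xs\<close> is itself a solution, so \<open>nearest y\<close> is at most
      as far from \<open>y\<close> as \<open>xs\<close> is. Halving the radius keeps it in the large
      ball.\<close>
    have sum: "rdist M xs y + rdist M y (nearest y) < b"
      using nearest_le[of y] y by simp
    then show nB: "nearest y \<in> rcball M xs b"
      using rdist_triangle[of xs "nearest y" y] by (intro rcball_I) simp
    show "tnorm M y (?v y) \<le> c * rdist M y (nearest y)"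
      using Rinv_le[OF yB sum] .
    have Rv: "R y (?v y) = nearest y"
      using R_Rinv[OF U_nearest[OF yB]] .
    \<comment> \<open>The ray from \<open>y\<close> to \<open>nearest y\<close> might leave the ball, but then it is longer than \<open>b / 2\<close> anyway.\<close>
    show "rdist M y (nearest y) \<le> c * tnorm M y (?v y)"
    proof (cases "rdist M xs y + c * tnorm M y (?v y) < b")
      case True
      then show ?thesis
        using ray(3)[OF yB, of "?v y"] Rv by simp
    next
      case False
      then show ?thesis
        using nearest_le[of y] y by simp
    qed
    show "c2 * tnorm M y (?v y) \<le> norm (F y)"
      using c2(2)[OF yB] F_nearest[of y] by simp
    show "norm (F y) \<le> L * tnorm M y (?v y)"
      using L(2)[OF yB nB] F_nearest[of y] by simp
    show "norm (F y + jac M F y (?v y)) \<le> c1 * (tnorm M y (?v y))\<^sup>2"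
      using c1(2)[OF yB nB] F_nearest[of y] by (simp add: add.commute)
  qed

  \<comment> \<open>Orthogonality of \<open>F y\<close> to the range of the Jacobian gives
    \<open>|F y| \<le> c1 |v|^2\<close>. Together with the error bound this forces
    \<open>|v| \<ge> c2 / c1\<close>, too large for the half ball by the choice of
    \<open>b\<close>.\<close>
  have critical: "F y = 0" if y: "rdist M xs y < b / 2" and g: "grad M (half_sq F) y = 0" for y
  proof (rule ccontr)
    assume Fy: "F y \<noteq> 0"
    let ?n = "tnorm M y (?v y)"
    have "F y \<bullet> jac M F y (?v y) = 0"
      using metric_grad_half_sq[OF F_C1, of y "?v y"] g bilinear_lzero[OF metric_bilinear] by simp
    then have "(norm (F y))\<^sup>2 = F y \<bullet> (F y + jac M F y (?v y))"
      by (simp add: inner_add_right power2_norm_eq_inner)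
    also have "\<dots> \<le> norm (F y) * norm (F y + jac M F y (?v y))"
      by (rule norm_cauchy_schwarz)
    also have "\<dots> \<le> norm (F y) * (c1 * ?n\<^sup>2)"
      using near(7)[OF y] by (intro mult_left_mono) auto
    finally have "norm (F y) \<le> c1 * ?n\<^sup>2"
      using Fy by (simp add: power2_eq_square)
    then have "?n * c2 \<le> ?n * (c1 * ?n)"
      using near(5)[OF y] by (simp add: power2_eq_square mult_ac)
    moreover have "?n > 0"
      using near(6)[OF y] Fy by (auto simp: order_less_le)
    ultimately have "c2 \<le> c1 * ?n"
      by simp
    also have "\<dots> \<le> c4 * ?n"
      using c4_gt by (intro mult_right_mono) auto
    also have "\<dots> < c4 * (c * (b / 2))"
    proof (rule mult_strict_left_mono)
      have "?n \<le> c * rdist M y (nearest y)"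
        by (rule near(3)[OF y])
      also have "\<dots> < c * (b / 2)"
        using nearest_le[of y] y c_ge1 by (intro mult_strict_left_mono) auto
      finally show "?n < c * (b / 2)" .
    qed (use c4_gt c1(1) in simp)
    also have "\<dots> \<le> c2"
      using b_c4 c_ge1 c4_gt c1(1) by (simp add: field_simps)
    finally show False
      by simp
  qed

  \<comment> \<open>The term \<open>c^2 * c3 * Dist k\<close> bounds the length of the step: one
    factor \<open>c\<close> passes from the distance to \<open>|v|\<close>, \<open>c3\<close> from
    \<open>|v|\<close> to \<open>|s k|\<close>, and the second \<open>c\<close> back to a distance.
    The premise thus keeps the next iterate in the half ball too.\<close>
  have step: "rdist M (x k) (x (Suc k)) \<le> c\<^sup>2 * c3 * Dist k \<and> Dist (Suc k) \<le> c5 * (Dist k)\<^sup>2"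
    if small: "rdist M xs (x k) + c\<^sup>2 * c3 * Dist k < b / 2" for k
  proof -
    have Dk: "Dist k = rdist M (x k) (nearest (x k))"
      by (simp add: Dist_def Dist_eq)
    have "0 \<le> c\<^sup>2 * c3 * Dist k"
      using c3_pos rdist_nonneg by (simp add: Dk)
    then have y: "rdist M xs (x k) < b / 2"
      using small by simp
    then have succ: "lm_successful M R F \<eta> (\<mu> k) (x k) (s k)"
      using b_rs b_cs by (intro rs(2)) (auto simp: rcball_def rdist_sym[of "x k" xs])
    then have xk: "x (Suc k) = R (x k) (s k)"
      using run by (simp add: rlm_sequence_def)
    show ?thesis
    \<comment> \<open>At a zero of \<open>F\<close> the regularisation weight vanishes and the model
      does not control the step; there the convention \<open>s k = 0\<close> applies.\<close>
    proof (cases "F (x k) = 0")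
      case True
      then have "Dist k \<le> 0"
        using nearest[of "x k"] X[of "x k"] unfolding Dk is_nearest_def by (metis rdist_self)
      then have D0: "Dist k = 0"
        using rdist_nonneg by (simp add: Dk order_antisym)
      have "grad M (half_sq F) (x k) = 0"
        using True X[of "x k"] by (simp add: sol_set_def)
      then have "x (Suc k) = x k"
        using run xk by (simp add: rlm_sequence_def)
      then show ?thesis
        using D0 by (simp add: Dist_def)
    next
      case False
      let ?v = "?v (x k)"
      let ?nv = "tnorm M (x k) ?v" and ?ns = "tnorm M (x k) (s k)"
      have "is_arg_min (lm_model M F (\<mu> k) (x k)) (\<lambda>_. True) (s k)"
        using critical[OF y] False run unfolding rlm_sequence_def by metis
      then have "lm_model M F (\<mu> k) (x k) (s k) \<le> lm_model M F (\<mu> k) (x k) ?v"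
        by (simp add: is_arg_min_linorder)
      then have model: "(norm (F (x k) + jac M F (x k) (s k)))\<^sup>2 + \<mu> k * (norm (F (x k)))\<^sup>2 * ?ns\<^sup>2
          \<le> (norm (F (x k) + jac M F (x k) ?v))\<^sup>2 + \<mu> k * (norm (F (x k)))\<^sup>2 * ?nv\<^sup>2"
        by (simp add: lm_model_def Let_def)
      note lm = lm_step_bounds[OF norm_ge_zero norm_ge_zero norm_ge_zero tnorm_nonneg tnorm_nonneg
          c1(1) c2(1) L(1) inputs(3) model near(7,5,6)[OF y] \<mu>, folded c3_eq c4_eq]
      have ns: "?ns \<le> c3 * ?nv"
        using lm(2) False by simp
      have nv: "?nv \<le> c * Dist k"
        using near(3)[OF y] by (simp add: Dk)
      have "c * ?ns \<le> c * (c3 * (c * Dist k))"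
        using order_trans[OF ns mult_left_mono[OF nv]] c3_pos c_ge1 by (intro mult_left_mono) auto
      then have cs: "c * ?ns \<le> c\<^sup>2 * c3 * Dist k"
        by (simp add: power2_eq_square mult_ac)
      have kB: "x k \<in> rcball M xs b"
        by (rule near(1)[OF y])
      \<comment> \<open>The ray argument applies to \<open>s k\<close> and shows that it is the
        inverse retraction of the new iterate, so (a) measures the linearisation error of the step
        actually taken.\<close>
      have "rdist M xs (x k) + c * ?ns < b"
        using cs small b_pos by simp
      from ray[OF kB this]
      have sU: "s k \<in> U (x k)" and SkB: "x (Suc k) \<in> rcball M xs b"
        and d: "rdist M (x k) (x (Suc k)) \<le> c * ?ns"
        by (auto simp: xk)
      have y': "rdist M xs (x (Suc k)) < b / 2"
        using rdist_triangle[of xs "x (Suc k)" "x k"] d cs small by simp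
      have "norm (jac M F (x k) (s k) - (F (x (Suc k)) - F (x k))) \<le> c1 * ?ns\<^sup>2"
        using c1(2)[OF kB SkB] Rinv_R[OF kB sU] by (simp add: xk)
      moreover have "norm (F (x (Suc k))) \<le> norm (F (x k) + jac M F (x k) (s k)) +
          norm (jac M F (x k) (s k) - (F (x (Suc k)) - F (x k)))"
        using norm_triangle_ineq4[of "F (x k) + jac M F (x k) (s k)" "jac M F (x k) (s k) - (F (x (Suc k)) - F (x k))"]
        by simp
      moreover have "c1 * ?ns\<^sup>2 \<le> c1 * (c3\<^sup>2 * ?nv\<^sup>2)"
        using power_mono[OF ns, of 2] c1(1) by (simp add: power_mult_distrib)
      ultimately have "norm (F (x (Suc k))) \<le> (c1 * c3\<^sup>2 + c4) * ?nv\<^sup>2"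
        using lm(1) by (simp add: algebra_simps)
      also have "\<dots> \<le> (c1 * c3\<^sup>2 + c4) * (c * Dist k)\<^sup>2"
        using nv c1(1) c4_gt by (intro mult_left_mono power_mono add_nonneg_nonneg mult_nonneg_nonneg) auto
      finally have "c2 * tnorm M (x (Suc k)) (Rinv R U (x (Suc k)) (nearest (x (Suc k)))) \<le> (c1 * c3\<^sup>2 + c4) * (c * Dist k)\<^sup>2"
        using near(5)[OF y'] by simp
      \<comment> \<open>The additional factor \<open>c\<close> turns the norm at the new iterate
        into its distance from the solution set.\<close>
      then have "c * tnorm M (x (Suc k)) (Rinv R U (x (Suc k)) (nearest (x (Suc k)))) \<le> c * ((c1 * c3\<^sup>2 + c4) * (c * Dist k)\<^sup>2 / c2)"
        using c_ge1 c2(1) by (intro mult_left_mono) (simp_all add: field_simps)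
      also have "\<dots> = c5 * (Dist k)\<^sup>2"
        by (simp add: c5_eq power_mult_distrib power3_eq_cube power2_eq_square)
      finally have "Dist (Suc k) \<le> c5 * (Dist k)\<^sup>2"
        using near(4)[OF y'] by (simp add: Dist_def Dist_eq)
      then show ?thesis
        using d cs by simp
    qed
  qed

  \<comment> \<open>Geometric decay of the distances and step lengths\<close>
  define q where "q = c\<^sup>2 * c3 * r"
  \<comment> \<open>\<open>q\<close> bounds the step lengths by \<open>q / 2^k\<close>, with sum
    \<open>2 * q\<close>. The inequality is the first bound in \<open>r\<close>, as
    \<open>r + 2 * q = r * (1 + 2 * c^2 * c3)\<close>.\<close>
  have q: "q > 0" "r + 2 * q \<le> b / 2"
  proof -
    show "q > 0"
      using c_ge1 c3_pos r_pos by (simp add: q_def)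
    have "r \<le> b / (2 + 4 * c\<^sup>2 * c3)"
      by (simp add: r_eq)
    moreover have "2 + 4 * c\<^sup>2 * c3 > 0"
      using c3_pos by (intro add_pos_nonneg) auto
    ultimately show "r + 2 * q \<le> b / 2"
      by (simp add: q_def field_simps)
  qed
  have c5r: "c5 * r \<le> 1 / 2"
  proof -
    have "r \<le> 1 / (2 * c5)"
      by (simp add: r_eq)
    then show ?thesis
      using c5_pos by (simp add: field_simps)
  qed
  have Dist_nonneg: "0 \<le> Dist k" for k
    by (simp add: Dist_def Dist_eq rdist_nonneg)
  \<comment> \<open>Of the budget \<open>2 * q\<close>, the amount \<open>2 * q / 2^k\<close> is
    still left, and the next step uses at most half of it; this yields the strict
    inequality.\<close>
  have small: "rdist M xs (x k) + c\<^sup>2 * c3 * Dist k < b / 2"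
    if "Dist k \<le> r / 2 ^ k" "rdist M xs (x k) \<le> r + q * (2 - 2 / 2 ^ k)" for k
  proof -
    have "c\<^sup>2 * c3 * Dist k \<le> c\<^sup>2 * c3 * (r / 2 ^ k)"
      using that(1) c3_pos by (intro mult_left_mono) auto
    then have "c\<^sup>2 * c3 * Dist k \<le> q / 2 ^ k"
      by (simp add: q_def)
    moreover have "0 < q / 2 ^ k"
      using q(1) by simp
    ultimately show ?thesis
      using that(2) q(2) by (simp add: algebra_simps)
  qed
  \<comment> \<open>\<open>q * (2 - 2 / 2^k)\<close> is the sum of \<open>q / 2^j\<close> over
    \<open>j < k\<close>, the path length allowed before iteration \<open>k\<close>.\<close>
  have inv: "Dist k \<le> r / 2 ^ k \<and> rdist M xs (x k) \<le> r + q * (2 - 2 / 2 ^ k)" for k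
  proof (induction k)
    case 0
    show ?case
      using x0 nearest_le[of "x 0"] by (simp add: Dist_def Dist_eq rcball_def)
  next
    case (Suc k)
    then have Dk: "Dist k \<le> r / 2 ^ k" and xk: "rdist M xs (x k) \<le> r + q * (2 - 2 / 2 ^ k)"
      by auto
    note st = step[OF small[OF Dk xk]]
    have "Dist (Suc k) \<le> c5 * (Dist k)\<^sup>2"
      using st by blast
    also have "\<dots> \<le> c5 * (r / 2 ^ k)\<^sup>2"
      using Dk Dist_nonneg c5_pos by (intro mult_left_mono power_mono) auto
    also have "\<dots> = (c5 * r) * (r / 2 ^ k) * (1 / 2 ^ k)"
      by (simp add: power2_eq_square)
    also have "\<dots> \<le> (1 / 2) * (r / 2 ^ k) * 1"
      using c5r r_pos c5_pos by (intro mult_mono) auto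
    finally have "Dist (Suc k) \<le> r / 2 ^ Suc k"
      by simp
    moreover have "c\<^sup>2 * c3 * Dist k \<le> c\<^sup>2 * c3 * (r / 2 ^ k)"
      using Dk c3_pos by (intro mult_left_mono) auto
    then have "rdist M xs (x (Suc k)) \<le> r + q * (2 - 2 / 2 ^ k) + q / 2 ^ k"
      using rdist_triangle[of xs "x (Suc k)" "x k"] st xk by (simp add: q_def)
    then have "rdist M xs (x (Suc k)) \<le> r + q * (2 - 2 / 2 ^ Suc k)"
      by (simp add: algebra_simps)
    ultimately show ?case
      by blast
  qed
  have st: "rdist M (x k) (x (Suc k)) \<le> c\<^sup>2 * c3 * Dist k" "Dist (Suc k) \<le> c5 * (Dist k)\<^sup>2" for k
    using step[OF small, of k] inv[of k] by simp_all
  have half: "(\<lambda>k. a / 2 ^ k) \<longlonglongrightarrow> 0" for a :: real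
    by (rule LIMSEQ_divide_realpow_zero) simp

  \<comment> \<open>Quadratic convergence of the distances and convergence of the iterates\<close>
  have "Dist \<longlonglongrightarrow> 0"
    by (rule tendsto_sandwich[OF _ _ tendsto_const half[of r]]) (auto simp: Dist_nonneg inv)
  then have "quadratically_to_0 Dist"
    unfolding quadratically_to_0_def using st(2) by blast
  moreover have "\<exists>xh \<in> rcball M xs (b / 2). rconverges M x xh"
  proof -
    \<comment> \<open>The bound is the exact geometric sum rather than its limit, so that the
      induction over \<open>j\<close> telescopes.\<close>
    have tail: "rdist M (x m) (x (m + j)) \<le> 2 * q / 2 ^ m - 2 * q / 2 ^ (m + j)" for m j
    proof (induction j)
      case (Suc j)
      have "c\<^sup>2 * c3 * Dist (m + j) \<le> c\<^sup>2 * c3 * (r / 2 ^ (m + j))"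
        using inv c3_pos by (intro mult_left_mono) auto
      then have "rdist M (x (m + j)) (x (m + Suc j)) \<le> q / 2 ^ (m + j)"
        using st(1)[of "m + j"] by (simp add: q_def)
      then show ?case
        using Suc rdist_triangle[of "x m" "x (m + Suc j)" "x (m + j)"] by simp
    qed simp
    have cauchy: "\<exists>N. \<forall>m\<ge>N. \<forall>k\<ge>N. rdist M (x m) (x k) < e" if e: "e > 0" for e
    proof -
      obtain N where N: "2 * q / 2 ^ N < e"
        using order_tendstoD(2)[OF half[of "2 * q"] e] by (auto simp: eventually_sequentially)
      have le: "rdist M (x m) (x k) < e" if "N \<le> m" "m \<le> k" for m k
      proof -
        have "rdist M (x m) (x k) \<le> 2 * q / 2 ^ m - 2 * q / 2 ^ k"
          using tail[of m "k - m"] that by simp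
        also have "\<dots> \<le> 2 * q / 2 ^ m"
          using q(1) by simp
        also have "\<dots> \<le> 2 * q / 2 ^ N"
          using q(1) that by (intro divide_left_mono power_increasing) auto
        finally show ?thesis
          using N by simp
      qed
      have "rdist M (x m) (x k) < e" if "N \<le> m" "N \<le> k" for m k
        using le[of m k] le[of k m] that rdist_sym[of "x m" "x k"] by (cases "m \<le> k") auto
      then show ?thesis
        by blast
    qed
    then obtain l where l: "rconverges M x l"
      using complete unfolding rcomplete_def by blast
    have "rdist M xs (x k) \<le> b / 2" for k
    proof -
      have "q * (2 - 2 / 2 ^ k) \<le> q * 2"
        using q(1) by (intro mult_left_mono) auto
      then show ?thesis
        using inv[of k] q(2) by simp
    qed
    \<comment> \<open>Letting \<open>k\<close> tend to infinity shows that the limit inherits the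
      non-strict bound on the radius.\<close>
    then have "rdist M xs l \<le> b / 2 + rdist M (x k) l" for k
      using rdist_triangle[of xs l "x k"] by (meson add_right_mono order_trans)
    moreover have "(\<lambda>k. b / 2 + rdist M (x k) l) \<longlonglongrightarrow> b / 2 + 0"
      using l unfolding rconverges_def by (intro tendsto_intros)
    ultimately have "rdist M xs l \<le> b / 2"
      using LIMSEQ_le_const by fastforce
    then show ?thesis
      using l by (auto simp: rcball_def)
  qed
  ultimately show ?thesis
    by (simp add: Dist_def[abs_def])
qed

end
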